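(* Let $k\ge 2$. Suppose a finite set of oriented circles is given, with the $j$-th circle of color $i$ ($1\le i\le k$) having length $l_{ij}>0$, all circles being distinguishable. Let $f(l_{ij})=\sum_C\mathrm{Vol}(C)$, the sum over all topological types $C$ of (not necessarily connected) circle constellations glued from exactly these circles, without isolated circles, and in which no three circles share a common point, where $\mathrm{Vol}(C)$ is the volume of the space of circle constellations of type $C$. Then $$f=\frac{1}{\prod_{i,j}l_{ij}}\sum_{(U_i,V_i)_{i}}(-1)^{|V_1|+\dots+|V_k|}\,e^{\frac12\sum_{i\ne j}L_iL_j},$$ where the sum is over all ways to divide, for each color $i$, the circles of color $i$ into two groups $U_i$ and $V_i$; $|V_i|$ is the number of circles in $V_i$; $L_i$ is the sum of lengths of the circles in $U_i$; and $\sum_{i\ne j}$ runs over ordered pairs of distinct colors.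
   Context: A circle constellation (here not necessarily connected) is an oriented graph with nonnegative edge lengths obtained by gluing together, at finitely many points, oriented circles of given lengths colored in colors $1,\dots,k$, such that no two circles of the same color share a point; it is naturally embedded in a compact oriented (possibly disconnected) surface so that cutting along the circles gives open discs, each circle bounds one disc and is oriented counterclockwise with respect to it, and the cyclic order of circles at every gluing point coincides with the increasing order of colors. An isolated circle is one glued to no other circle. The topological type of a circle constellation records, for each circle, its gluing points in cyclic order along the circle and, for each such point, which circles are glued there, but not the arc lengths. The space of circle constellations of a given type (no three circles sharing a point) is parametrized by the lengths of all but one of the arcs on each circle, and its volume is taken with respect to $|d\lambda_1\wedge\dots\wedge d\lambda_d|$ in these coordinates (constellations considered up to isomorphism). *)

theory Defs
  imports "HOL-Analysis.Analysis" "HOL-Combinatorics.Orbits"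
begin

text \<open>The circle \<open>(i, j)\<close> is the \<open>j\<close>-th circle of colour \<open>i\<close>.\<close>

type_synonym circle = "nat \<times> nat"

abbreviation colour :: "circle \<Rightarrow> nat" where
  "colour \<equiv> fst"

definition circles :: "nat \<Rightarrow> (nat \<Rightarrow> nat) \<Rightarrow> circle set" where
  "circles k m = (SIGMA i:{1..k}. {1..m i})"

text \<open>
  The combinatorial part of a circle constellation: \<open>gluing_points\<close> is a set of names for the
  gluing points, \<open>circles_at G p\<close> is the set of circles glued at \<open>p\<close>, and \<open>next_point G s p\<close> is the
  gluing point following \<open>p\<close> along the oriented circle \<open>s\<close>.  The names, and the values of the two
  functions at irrelevant arguments, are removed by \<open>same_type\<close> below.  The surface containing the
  constellation is not separate data: the cyclic order of the circles at each gluing point is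
  prescribed to be that of their colours, and this determines the ribbon graph.
\<close>

record gluing =
  gluing_points :: "nat set"
  circles_at :: "nat \<Rightarrow> circle set"
  next_point :: "circle \<Rightarrow> nat \<Rightarrow> nat"

definition points_on :: "gluing \<Rightarrow> circle \<Rightarrow> nat set" where
  "points_on G s = {p \<in> gluing_points G. s \<in> circles_at G p}"

definition is_gluing :: "circle set \<Rightarrow> gluing \<Rightarrow> bool" where
  "is_gluing S G \<longleftrightarrow>
     finite (gluing_points G) \<and>
     (\<forall>p \<in> gluing_points G.
        circles_at G p \<subseteq> S \<and> card (circles_at G p) \<ge> 2 \<and> inj_on colour (circles_at G p)) \<and>
     (\<forall>s \<in> S. points_on G s \<noteq> {} \<longrightarrow> cyclic_on (next_point G s) (points_on G s))"

definition isolated :: "gluing \<Rightarrow> circle \<Rightarrow> bool" where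
  "isolated G s \<longleftrightarrow> points_on G s = {}"

definition no_three_share :: "gluing \<Rightarrow> bool" where
  "no_three_share G \<longleftrightarrow> (\<forall>p \<in> gluing_points G. card (circles_at G p) < 3)"

text \<open>The circles are distinguishable, so an isomorphism maps every circle to itself.\<close>

definition gluing_iso :: "circle set \<Rightarrow> (nat \<Rightarrow> nat) \<Rightarrow> gluing \<Rightarrow> gluing \<Rightarrow> bool" where
  "gluing_iso S \<phi> G H \<longleftrightarrow>
     bij_betw \<phi> (gluing_points G) (gluing_points H) \<and>
     (\<forall>p \<in> gluing_points G. circles_at H (\<phi> p) = circles_at G p) \<and>
     (\<forall>s \<in> S. \<forall>p \<in> points_on G s. next_point H s (\<phi> p) = \<phi> (next_point G s p))"

definition same_type :: "circle set \<Rightarrow> (gluing \<times> gluing) set" where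
  "same_type S = {(G, H). is_gluing S G \<and> is_gluing S H \<and> (\<exists>\<phi>. gluing_iso S \<phi> G H)}"

lemma equiv_same_type: "equiv {G. is_gluing S G} (same_type S)"
proof (rule equivI)
  show "same_type S \<subseteq> {G. is_gluing S G} \<times> {G. is_gluing S G}"
    by (auto simp: same_type_def)
  have "gluing_iso S id G G" for G
    by (simp add: gluing_iso_def)
  then show "refl_on {G. is_gluing S G} (same_type S)"
    by (auto simp: same_type_def refl_on_def)
  have next_in: "next_point G s p \<in> points_on G s"
    if "is_gluing S G" "s \<in> S" "p \<in> points_on G s" for G s p
    using that cyclic_on_funpow_in[of "next_point G s" "points_on G s" p 1]
    by (auto simp: is_gluing_def)
  show "sym (same_type S)"
  proof (rule symI)
    fix G H assume GH: "(G, H) \<in> same_type S"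
    then obtain f where G: "is_gluing S G" and H: "is_gluing S H" and f: "gluing_iso S f G H"
      by (auto simp: same_type_def)
    define g where "g = the_inv_into (gluing_points G) f"
    have bij: "bij_betw f (gluing_points G) (gluing_points H)"
      using f by (simp add: gluing_iso_def)
    have gf: "g (f p) = p" if "p \<in> gluing_points G" for p
      using bij that by (simp add: g_def bij_betw_def the_inv_into_f_f)
    have fg: "f (g q) = q" "g q \<in> gluing_points G" if "q \<in> gluing_points H" for q
      using bij that f_the_inv_into_f_bij_betw[OF bij, of q] bij_betwE[OF bij_betw_the_inv_into[OF bij]]
      by (auto simp: g_def)
    have at: "circles_at G (g q) = circles_at H q" if "q \<in> gluing_points H" for q
      using f fg[OF that] by (auto simp: gluing_iso_def)
    have "next_point G s (g q) = g (next_point H s q)" if s: "s \<in> S" and q: "q \<in> points_on H s" for s q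
    proof -
      have qH: "q \<in> gluing_points H" using q by (simp add: points_on_def)
      have p: "g q \<in> points_on G s"
        using q qH fg at by (simp add: points_on_def)
      have "next_point H s (f (g q)) = f (next_point G s (g q))"
        using f s p by (simp add: gluing_iso_def)
      then show ?thesis
        using fg[OF qH] gf next_in[OF G s p] by (simp add: points_on_def)
    qed
    then have "gluing_iso S g H G"
      using at bij_betw_the_inv_into[OF bij] by (simp add: gluing_iso_def g_def)
    then show "(H, G) \<in> same_type S"
      using G H by (auto simp: same_type_def)
  qed
  show "trans (same_type S)"
  proof (rule transI)
    fix G H K assume "(G, H) \<in> same_type S" "(H, K) \<in> same_type S"
    then obtain f g where *: "is_gluing S G" "is_gluing S K"
      and f: "gluing_iso S f G H" and g: "gluing_iso S g H K"
      by (auto simp: same_type_def)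
    have fp: "f p \<in> gluing_points H" if "p \<in> gluing_points G" for p
      using f that by (auto simp: gluing_iso_def bij_betw_def)
    have "gluing_iso S (g \<circ> f) G K"
      using f g fp by (auto simp: gluing_iso_def points_on_def intro: bij_betw_trans)
    then show "(G, K) \<in> same_type S"
      using * by (auto simp: same_type_def)
  qed
qed

definition topological_types :: "circle set \<Rightarrow> gluing set set" where
  "topological_types S = {G. is_gluing S G} // same_type S"

definition simple_types :: "circle set \<Rightarrow> gluing set set" where
  "simple_types S =
     {C \<in> topological_types S. \<forall>G \<in> C. (\<forall>s \<in> S. \<not> isolated G s) \<and> no_three_share G}"

text \<open>The pair \<open>(s, p)\<close> names the arc of the circle \<open>s\<close> from \<open>p\<close> to the next gluing point.\<close>

definition arcs :: "circle set \<Rightarrow> gluing \<Rightarrow> (circle \<times> nat) set" where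
  "arcs S G = (SIGMA s:S. points_on G s)"

text \<open>
  A circle constellation is a pair \<open>(G, \<alpha>)\<close> of a gluing \<open>G\<close> and an element \<open>\<alpha>\<close> of the following
  set of arc lengths.
\<close>

definition arc_lengths ::
    "circle set \<Rightarrow> (circle \<Rightarrow> real) \<Rightarrow> gluing \<Rightarrow> (circle \<times> nat \<Rightarrow> real) set" where
  "arc_lengths S len G =
     {\<alpha> \<in> arcs S G \<rightarrow>\<^sub>E {0..}.
        \<forall>s \<in> S. points_on G s \<noteq> {} \<longrightarrow> (\<Sum>p \<in> points_on G s. \<alpha> (s, p)) = len s}"

definition constellation_iso ::
    "circle set \<Rightarrow> gluing \<times> (circle \<times> nat \<Rightarrow> real) \<Rightarrow> gluing \<times> (circle \<times> nat \<Rightarrow> real) \<Rightarrow> bool" where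
  "constellation_iso S = (\<lambda>(G, \<alpha>) (H, \<mu>).
     \<exists>\<phi>. gluing_iso S \<phi> G H \<and> (\<forall>(s, p) \<in> arcs S G. \<mu> (s, \<phi> p) = \<alpha> (s, p)))"

text \<open>
  The coordinates are the lengths of all arcs but one on each circle.  Omitting the arc that starts
  at the least point name is an arbitrary choice: the lengths on a circle have a fixed sum, so
  another choice changes the coordinates by an affine map of determinant \<open>\<plusminus> 1\<close>.
\<close>

definition coordinate_arcs :: "circle set \<Rightarrow> gluing \<Rightarrow> (circle \<times> nat) set" where
  "coordinate_arcs S G = {(s, p) \<in> arcs S G. p \<noteq> Min (points_on G s)}"

definition coordinates ::
    "circle set \<Rightarrow> gluing \<Rightarrow> (circle \<times> nat \<Rightarrow> real) \<Rightarrow> (circle \<times> nat \<Rightarrow> real)" where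
  "coordinates S G \<alpha> = restrict \<alpha> (coordinate_arcs S G)"

lemma inj_on_coordinates:
  assumes "is_gluing S G"
  shows "inj_on (coordinates S G) (arc_lengths S len G)"
proof (rule inj_onI)
  fix \<alpha> \<mu>
  assume l: "\<alpha> \<in> arc_lengths S len G" and m: "\<mu> \<in> arc_lengths S len G"
    and eq: "coordinates S G \<alpha> = coordinates S G \<mu>"
  have coord: "\<alpha> a = \<mu> a" if "a \<in> coordinate_arcs S G" for a
    using fun_cong[OF eq, of a] that by (simp add: coordinates_def)
  have "\<alpha> (s, p) = \<mu> (s, p)" if "(s, p) \<in> arcs S G" for s p
  proof (cases "p = Min (points_on G s)")
    case False
    then show ?thesis using coord that by (simp add: coordinate_arcs_def)
  next
    case True
    have s: "s \<in> S" and p: "p \<in> points_on G s"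
      using that by (auto simp: arcs_def)
    have fin: "finite (points_on G s)"
      using assms by (auto simp: is_gluing_def points_on_def)
    have "(\<Sum>q \<in> points_on G s. \<alpha> (s, q)) = (\<Sum>q \<in> points_on G s. \<mu> (s, q))"
    proof -
      have "points_on G s \<noteq> {}" using p by auto
      then show ?thesis using l m s by (simp add: arc_lengths_def)
    qed
    moreover have "(\<Sum>q \<in> points_on G s - {p}. \<alpha> (s, q)) = (\<Sum>q \<in> points_on G s - {p}. \<mu> (s, q))"
      using s True by (intro sum.cong refl coord) (auto simp: coordinate_arcs_def arcs_def)
    ultimately show ?thesis
      using sum.remove[OF fin p, of "\<lambda>q. \<alpha> (s, q)"] sum.remove[OF fin p, of "\<lambda>q. \<mu> (s, q)"]
      by simp
  qed
  then show "\<alpha> = \<mu>"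
    using l m by (intro PiE_ext[of \<alpha> "arcs S G" "\<lambda>_. {0..}" \<mu>]) (auto simp: arc_lengths_def)
qed

text \<open>
  The volume of the space of isomorphism classes of constellations with underlying gluing \<open>G\<close>.
  An isomorphism class is represented by finitely many points of the coordinate domain; every
  point is weighted by the reciprocal of their number, so that each class is counted once.
\<close>

definition gluing_volume :: "circle set \<Rightarrow> (circle \<Rightarrow> real) \<Rightarrow> gluing \<Rightarrow> real" where
  "gluing_volume S len G =
     enn2real (\<integral>\<^sup>+ x \<in> coordinates S G ` arc_lengths S len G.
       ennreal (1 / real (card {\<mu> \<in> arc_lengths S len G.
         constellation_iso S (G, the_inv_into (arc_lengths S len G) (coordinates S G) x) (G, \<mu>)}))
       \<partial>(\<Pi>\<^sub>M a \<in> coordinate_arcs S G. lborel))"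

definition type_volume :: "circle set \<Rightarrow> (circle \<Rightarrow> real) \<Rightarrow> gluing set \<Rightarrow> real" where
  "type_volume S len C = gluing_volume S len (SOME G. G \<in> C)"

definition divisions ::
    "nat \<Rightarrow> (nat \<Rightarrow> nat) \<Rightarrow> ((nat \<Rightarrow> nat set) \<times> (nat \<Rightarrow> nat set)) set" where
  "divisions k m =
     {(U, V). U \<in> (\<Pi>\<^sub>E i \<in> {1..k}. Pow {1..m i}) \<and> V \<in> (\<Pi>\<^sub>E i \<in> {1..k}. Pow {1..m i}) \<and>
        (\<forall>i \<in> {1..k}. U i \<union> V i = {1..m i} \<and> U i \<inter> V i = {})}"

end

theory Submission
  imports Defs
begin

text \<open>
  Let \<open>d\<^sub>s\<close> be the number of gluing points on the circle \<open>s\<close>.  The arc lengths on \<open>s\<close> range over a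
  simplex of volume \<open>l\<^sub>s\<^bsup>d\<^sub>s - 1\<^esup> / (d\<^sub>s - 1)!\<close>, and outside a null set the automorphism group of the
  gluing acts freely, so the volume of a type is the product of these simplex volumes divided by the
  order of that group.  A type with \<open>n\<close> gluing points has \<open>n! / |Aut|\<close> labellings of its points by
  \<open>{..<n}\<close>, and a labelled gluing is a map \<open>c\<close> from \<open>{..<n}\<close> to pairs of circles of distinct colours,
  covering all circles, together with one of \<open>(d\<^sub>s - 1)!\<close> cyclic orders on each circle.  The factorials
  cancel, and the types with \<open>n\<close> points contribute \<open>1 / (n! \<Prod> l\<^sub>s)\<close> times the sum over all \<open>c\<close> of
  the product of the \<open>l\<^sub>s\<close> over all incidences \<open>s \<in> c p\<close>.  Inclusion-exclusion over the set \<open>U\<close> of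
  circles that \<open>c\<close> may use turns this into \<open>n\<close>-th powers, and summing over \<open>n\<close> gives the exponentials.
\<close>

subsection \<open>Simplices and level sets in product spaces\<close>

text \<open>Fubini with the coordinate \<open>a\<close> integrated first: along every line in
  direction \<open>a\<close> the function is affine with slope \<open>c \<noteq> 0\<close>, so the
  line meets the level set in at most one point.\<close>

lemma AE_PiM_lborel_not_level_set:
  fixes f :: "('i \<Rightarrow> real) \<Rightarrow> real"
  assumes fin: "finite I" and a: "a \<in> I" and c: "c \<noteq> 0"
    and f[measurable]: "f \<in> borel_measurable (Pi\<^sub>M I (\<lambda>_. lborel))"
    and affine: "\<And>x y. f (x(a := y)) = f (x(a := 0)) + c * y"
  shows "AE x in Pi\<^sub>M I (\<lambda>_. lborel). f x \<noteq> t"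
proof -
  interpret product_sigma_finite "\<lambda>_::'i. lborel :: real measure" by standard
  let ?M = "\<lambda>I. Pi\<^sub>M I (\<lambda>_::'i. lborel :: real measure)"
  define N where "N = {x \<in> space (?M I). f x = t}"
  have N[measurable]: "N \<in> sets (?M I)" unfolding N_def by measurable
  define J where "J = I - {a}"
  have J: "I = insert a J" "finite J" "a \<notin> J" using a fin by (auto simp: J_def)
  have "emeasure (?M I) N = (\<integral>\<^sup>+ x. indicator N x \<partial>?M I)"
    using N by (rule nn_integral_indicator[symmetric])
  also have "\<dots> = (\<integral>\<^sup>+ x. (\<integral>\<^sup>+ y. indicator N (x(a := y)) \<partial>lborel) \<partial>?M J)"
    unfolding J(1) using N J by (intro product_nn_integral_insert) auto
  also have "\<dots> = (\<integral>\<^sup>+ x. 0 \<partial>?M J)"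
  proof (intro nn_integral_cong)
    fix x
    have "(\<integral>\<^sup>+ y. indicator N (x(a := y)) \<partial>lborel)
        \<le> (\<integral>\<^sup>+ y. indicator {(t - f (x(a := 0))) / c} y \<partial>lborel)"
    proof (intro nn_integral_mono)
      fix y :: real
      have "y = (t - f (x(a := 0))) / c" if "x(a := y) \<in> N"
        using that affine[of x y] c by (simp add: N_def field_simps)
      then show "(indicator N (x(a := y)) :: ennreal) \<le> indicator {(t - f (x(a := 0))) / c} y"
        by (auto simp: indicator_def)
    qed
    also have "\<dots> = 0" by (subst nn_integral_indicator) auto
    finally show "(\<integral>\<^sup>+ y. indicator N (x(a := y)) \<partial>lborel) = 0" by simp
  qed
  finally have "emeasure (?M I) N = 0" by simp
  then show ?thesis by (intro AE_I'[of N]) (auto simp: N_def)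
qed

text \<open>The set is a product of simplices, one for each \<open>s\<close>, because every
  constraint involves the coordinates of a single \<open>s\<close>. Induction on the index set
  splits off one simplex at a time by Fubini.\<close>

lemma emeasure_PiM_Sigma_simplices:
  fixes P :: "'a \<Rightarrow> 'b set" and t :: "'a \<Rightarrow> real"
  assumes "finite S" and fin: "\<And>s. s \<in> S \<Longrightarrow> finite (P s)" and t: "\<And>s. s \<in> S \<Longrightarrow> t s \<ge> 0"
  shows "{x \<in> Sigma S P \<rightarrow>\<^sub>E {0..}. \<forall>s\<in>S. (\<Sum>p\<in>P s. x (s, p)) \<le> t s}
           \<in> sets (Pi\<^sub>M (Sigma S P) (\<lambda>_. lborel))" (is "?A S \<in> _")
    and "emeasure (Pi\<^sub>M (Sigma S P) (\<lambda>_. lborel))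
           {x \<in> Sigma S P \<rightarrow>\<^sub>E {0..}. \<forall>s\<in>S. (\<Sum>p\<in>P s. x (s, p)) \<le> t s} =
         ennreal (\<Prod>s\<in>S. t s ^ card (P s) / fact (card (P s)))"
proof -
  let ?M = "\<lambda>I. Pi\<^sub>M I (\<lambda>_::'a \<times> 'b. lborel :: real measure)"
  interpret product_sigma_finite "\<lambda>_::'a \<times> 'b. lborel :: real measure" by standard
  have meas: "?A T \<in> sets (?M (Sigma T P))" if T: "finite T" "T \<subseteq> S" for T
  proof -
    have [simp]: "finite (Sigma T P)" using T fin by auto
    have "?A T = {x \<in> space (?M (Sigma T P)). (\<forall>i\<in>Sigma T P. 0 \<le> x i) \<and>
            (\<forall>s\<in>T. (\<Sum>p\<in>P s. x (s, p)) \<le> t s)}"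
      by (auto simp: space_PiM PiE_def Pi_def)
    also have "\<dots> \<in> sets (?M (Sigma T P))"
      using T by measurable
    finally show ?thesis .
  qed
  show "?A S \<in> sets (?M (Sigma S P))" using meas assms(1) by simp
  have "emeasure (?M (Sigma T P)) (?A T) = ennreal (\<Prod>s\<in>T. t s ^ card (P s) / fact (card (P s)))"
    if "T \<subseteq> S" "finite T" for T
    using that(2,1)
  proof (induction T rule: finite_induct)
    case empty
    then show ?case by (simp add: PiM_empty)
  next
    case (insert s T)
    \<comment> \<open>\<open>?I\<close> indexes the coordinates of the new simplex,
      \<open>?J\<close> those of the simplices already treated.\<close>
    let ?I = "Sigma {s} P" and ?J = "Sigma T P"
    define B where "B = {x. (\<forall>i\<in>?I. 0 \<le> x i) \<and> sum x ?I \<le> t s} \<inter> space (?M ?I)"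
    have IJ: "Sigma (insert s T) P = ?I \<union> ?J" "?I \<inter> ?J = {}" using insert by auto
    have finI: "finite ?I" "finite ?J" using insert fin by auto
    have sumI: "sum x ?I = (\<Sum>p\<in>P s. x (s, p))" for x :: "'a \<times> 'b \<Rightarrow> real"
      using insert fin by (subst sum.Sigma[of "{s}" P "\<lambda>s p. x (s, p)", simplified, symmetric]) auto
    have B_eq: "B = ?A {s}"
      by (auto simp: B_def space_PiM PiE_def Pi_def sumI)
    have [measurable]: "B \<in> sets (?M ?I)"
      unfolding B_eq using meas[of "{s}"] insert by simp
    have [measurable]: "?A T \<in> sets (?M ?J)" using meas insert by simp
    have B: "emeasure (?M ?I) B = ennreal (t s ^ card (P s) / fact (card (P s)))"
      using emeasure_std_simplex_aux[OF finI(1), of "t s"] insert t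
      by (simp add: B_def card_SigmaI fin)
    have "emeasure (?M (Sigma (insert s T) P)) (?A (insert s T)) =
        (\<integral>\<^sup>+ x. indicator (?A (insert s T)) x \<partial>?M (?I \<union> ?J))"
      using meas[of "insert s T"] insert unfolding IJ by (intro nn_integral_indicator[symmetric]) auto
    also have "\<dots> = (\<integral>\<^sup>+ x. (\<integral>\<^sup>+ y. indicator (?A (insert s T)) (merge ?I ?J (x, y)) \<partial>?M ?J) \<partial>?M ?I)"
      using meas[of "insert s T"] insert IJ finI
      by (intro product_nn_integral_fold) auto
    also have "\<dots> = (\<integral>\<^sup>+ x. (\<integral>\<^sup>+ y. indicator B x * indicator (?A T) y \<partial>?M ?J) \<partial>?M ?I)"
    proof (intro nn_integral_cong)
      fix x y assume x: "x \<in> space (?M ?I)" and y: "y \<in> space (?M ?J)"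
      have m1: "merge ?I ?J (x, y) (s, p) = x (s, p)" if "p \<in> P s" for p
        using that by (simp add: merge_def)
      have m2: "merge ?I ?J (x, y) (u, p) = y (u, p)" if "p \<in> P u" "u \<in> T" for u p
        using that insert by (auto simp: merge_def)
      have m3: "merge ?I ?J (x, y) \<in> extensional (Sigma (insert s T) P)"
        unfolding IJ(1) by (rule extensional_merge)
      have A_iff: "z \<in> ?A R \<longleftrightarrow> z \<in> extensional (Sigma R P) \<and>
          (\<forall>u\<in>R. (\<forall>p\<in>P u. 0 \<le> z (u, p)) \<and> (\<Sum>p\<in>P u. z (u, p)) \<le> t u)" for z R
        by (auto simp: PiE_def Pi_def)
      \<comment> \<open>No constraint mixes the two blocks of coordinates, so the indicator of the
        merged point factors.\<close>
      have "merge ?I ?J (x, y) \<in> ?A (insert s T) \<longleftrightarrow> x \<in> B \<and> y \<in> ?A T"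
        using x y m3 unfolding B_eq A_iff
        by (simp add: m1 m2 space_PiM PiE_def cong: sum.cong)
      then show "(indicator (?A (insert s T)) (merge ?I ?J (x, y)) :: ennreal) =
          indicator B x * indicator (?A T) y"
        by (simp add: indicator_def)
    qed
    also have "\<dots> = emeasure (?M ?I) B * emeasure (?M ?J) (?A T)"
      by (simp add: nn_integral_cmult nn_integral_multc)
    also have "\<dots> = ennreal (t s ^ card (P s) / fact (card (P s))) *
        ennreal (\<Prod>s\<in>T. t s ^ card (P s) / fact (card (P s)))"
      using insert B by simp
    also have "\<dots> = ennreal (\<Prod>s\<in>insert s T. t s ^ card (P s) / fact (card (P s)))"
      using insert t by (subst ennreal_mult[symmetric]) (auto intro!: prod_nonneg)
    finally show ?case .
  qed
  then show "emeasure (?M (Sigma S P)) (?A S) =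
      ennreal (\<Prod>s\<in>S. t s ^ card (P s) / fact (card (P s)))"
    using assms(1) by simp
qed

subsection \<open>The volume of a gluing\<close>

text \<open>Extensionality identifies maps that differ only away from the gluing points, which makes
  the set finite. For \<open>H = G\<close> its cardinality is the order of the automorphism
  group.\<close>

definition gluing_isos :: "circle set \<Rightarrow> gluing \<Rightarrow> gluing \<Rightarrow> (nat \<Rightarrow> nat) set" where
  "gluing_isos S G H = {\<phi> \<in> extensional (gluing_points G). gluing_iso S \<phi> G H}"

lemma finite_points_on: "is_gluing S G \<Longrightarrow> finite (points_on G s)"
  by (auto simp: is_gluing_def points_on_def)

lemma gluing_point_on_some_circle:
  assumes "is_gluing S G" "p \<in> gluing_points G"
  obtains s where "s \<in> S" "p \<in> points_on G s"
proof -
  have "card (circles_at G p) \<ge> 2" "circles_at G p \<subseteq> S"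
    using assms by (auto simp: is_gluing_def)
  then have "circles_at G p \<noteq> {}" by auto
  then show ?thesis
    using that assms(2) \<open>circles_at G p \<subseteq> S\<close> by (auto simp: points_on_def)
qed

lemma gluing_iso_points_on:
  assumes "gluing_iso S \<phi> G H"
  shows "bij_betw \<phi> (points_on G s) (points_on H s)"
proof -
  have b: "bij_betw \<phi> (gluing_points G) (gluing_points H)"
    and c: "\<And>p. p \<in> gluing_points G \<Longrightarrow> circles_at H (\<phi> p) = circles_at G p"
    using assms by (auto simp: gluing_iso_def)
  from b have "\<phi> ` points_on G s = points_on H s"
    by (force simp: points_on_def bij_betw_def c)
  then show ?thesis
    using b by (auto simp: bij_betw_def points_on_def intro: inj_on_subset)
qed

lemma next_point_in:
  "is_gluing S G \<Longrightarrow> s \<in> S \<Longrightarrow> p \<in> points_on G s \<Longrightarrow> next_point G s p \<in> points_on G s"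
  by (auto simp: is_gluing_def intro: cyclic_on_inI)

text \<open>The successor of a gluing point on a circle is again a gluing point, so the conditions
  evaluate \<open>\<phi>\<close> at gluing points only.\<close>

lemma gluing_iso_restrict:
  assumes G: "is_gluing S G"
  shows "gluing_iso S (restrict \<phi> (gluing_points G)) G H \<longleftrightarrow> gluing_iso S \<phi> G H"
proof -
  have P: "points_on G s \<subseteq> gluing_points G" for s by (auto simp: points_on_def)
  show ?thesis
    using subsetD[OF P next_point_in[OF G]] subsetD[OF P] unfolding gluing_iso_def
    by (simp add: bij_betw_restrict_eq)
qed

lemma arc_lengths_nonneg:
  assumes "\<alpha> \<in> arc_lengths S len G" "s \<in> S" "p \<in> points_on G s"
  shows "0 \<le> \<alpha> (s, p)"
  using assms PiE_mem[of \<alpha> "arcs S G" "\<lambda>_. {0..}" "(s, p)"]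
  by (simp add: arc_lengths_def arcs_def)

text \<open>Orbit counting for a free action: automorphisms transport arc lengths, and the orbit of
  \<open>\<alpha>\<close> is in bijection with the automorphism group. Since automorphisms fix every
  circle, distinctness of the lengths within each circle suffices for a trivial stabiliser.\<close>

lemma card_constellation_orbit:
  assumes G: "is_gluing S G" and \<alpha>: "\<alpha> \<in> arc_lengths S len G"
    and inj: "\<And>s. s \<in> S \<Longrightarrow> inj_on (\<lambda>p. \<alpha> (s, p)) (points_on G s)"
  shows "card {\<mu> \<in> arc_lengths S len G. constellation_iso S (G, \<alpha>) (G, \<mu>)} =
    card (gluing_isos S G G)" (is "card ?O = _")
proof -
  let ?P = "gluing_points G"
  \<comment> \<open>The transported lengths: the arc starting at \<open>q\<close> gets the length of
    the arc starting at the preimage of \<open>q\<close>.\<close>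
  define push where
    "push \<phi> = restrict (\<lambda>(s, q). \<alpha> (s, the_inv_into ?P \<phi> q)) (arcs S G)" for \<phi>
  have push_apply: "push \<phi> (s, \<phi> p) = \<alpha> (s, p)"
    if "gluing_iso S \<phi> G G" "s \<in> S" "p \<in> points_on G s" for \<phi> s p
  proof -
    have "\<phi> p \<in> points_on G s"
      using gluing_iso_points_on[OF that(1), of s] that(3) by (auto simp: bij_betw_def)
    moreover have "the_inv_into ?P \<phi> (\<phi> p) = p"
      using that by (intro the_inv_into_f_f) (auto simp: gluing_iso_def bij_betw_def points_on_def)
    ultimately show ?thesis using that(2) by (simp add: push_def arcs_def)
  qed
  have inj_push: "inj_on push (gluing_isos S G G)"
  proof (rule inj_onI)
    fix \<phi> \<psi> assume f: "\<phi> \<in> gluing_isos S G G" and g: "\<psi> \<in> gluing_isos S G G"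
      and eq: "push \<phi> = push \<psi>"
    have f': "gluing_iso S \<phi> G G" and g': "gluing_iso S \<psi> G G"
      using f g by (auto simp: gluing_isos_def)
    show "\<phi> = \<psi>"
    proof (rule extensionalityI)
      fix p assume p: "p \<in> ?P"
      obtain s where s: "s \<in> S" "p \<in> points_on G s"
        using gluing_point_on_some_circle[OF G p] .
      \<comment> \<open>Both maps permute the points of \<open>s\<close>, so
        \<open>\<phi> p = \<psi> q\<close> for some \<open>q\<close> on \<open>s\<close>. Comparing
        the transported lengths there gives equal lengths at \<open>p\<close> and \<open>q\<close>,
        hence \<open>p = q\<close>.\<close>
      have "\<phi> p \<in> \<psi> ` points_on G s"
        using gluing_iso_points_on[OF f', of s] gluing_iso_points_on[OF g', of s] s
        by (auto simp: bij_betw_def)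
      then obtain q where q: "q \<in> points_on G s" "\<phi> p = \<psi> q" by auto
      have "\<alpha> (s, p) = \<alpha> (s, q)"
        using push_apply[OF f' s] push_apply[OF g' s(1) q(1)] eq q(2) by simp
      then have "p = q" using inj[OF s(1)] s(2) q(1) by (auto dest: inj_onD)
      then show "\<phi> p = \<psi> p" using q by simp
    qed (use f g in \<open>auto simp: gluing_isos_def\<close>)
  qed
  have "push ` gluing_isos S G G = ?O"
  proof (intro equalityI subsetI)
    fix \<mu> assume "\<mu> \<in> push ` gluing_isos S G G"
    then obtain \<phi> where \<phi>: "gluing_iso S \<phi> G G" and \<mu>: "\<mu> = push \<phi>"
      by (auto simp: gluing_isos_def)
    have "push \<phi> (s, q) \<ge> 0" if "s \<in> S" "q \<in> points_on G s" for s q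
    proof -
      obtain p where "p \<in> points_on G s" "q = \<phi> p"
        using gluing_iso_points_on[OF \<phi>, of s] \<open>q \<in> points_on G s\<close> by (auto simp: bij_betw_def)
      then show ?thesis
        using push_apply[OF \<phi>] that arc_lengths_nonneg[OF \<alpha>] by simp
    qed
    moreover have "(\<Sum>q\<in>points_on G s. push \<phi> (s, q)) = len s"
      if "s \<in> S" "points_on G s \<noteq> {}" for s
    proof -
      have "(\<Sum>q\<in>points_on G s. push \<phi> (s, q)) = (\<Sum>p\<in>points_on G s. push \<phi> (s, \<phi> p))"
        using gluing_iso_points_on[OF \<phi>] by (rule sum.reindex_bij_betw[symmetric])
      also have "\<dots> = (\<Sum>p\<in>points_on G s. \<alpha> (s, p))"
        using push_apply[OF \<phi>] that by simp
      finally show ?thesis using \<alpha> that by (simp add: arc_lengths_def)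
    qed
    ultimately have "\<mu> \<in> arc_lengths S len G"
      unfolding \<mu> arc_lengths_def by (auto simp: arcs_def push_def)
    moreover have "constellation_iso S (G, \<alpha>) (G, \<mu>)"
      unfolding constellation_iso_def \<mu> using \<phi> push_apply[OF \<phi>] by (auto simp: arcs_def)
    ultimately show "\<mu> \<in> ?O" by simp
  next
    fix \<mu> assume "\<mu> \<in> ?O"
    then obtain \<phi> where \<phi>: "gluing_iso S \<phi> G G" and \<mu>: "\<mu> \<in> arc_lengths S len G"
      and eq: "\<And>s p. (s, p) \<in> arcs S G \<Longrightarrow> \<mu> (s, \<phi> p) = \<alpha> (s, p)"
      by (auto simp: constellation_iso_def)
    have P: "points_on G s \<subseteq> ?P" for s by (auto simp: points_on_def)
    have r: "gluing_iso S (restrict \<phi> ?P) G G"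
      using \<phi> by (simp add: gluing_iso_restrict[OF G])
    have "\<mu> = push (restrict \<phi> ?P)"
    proof (rule extensionalityI[of _ "arcs S G"])
      fix a assume a: "a \<in> arcs S G"
      then obtain s q where sq: "a = (s, q)" "s \<in> S" "q \<in> points_on G s" by (auto simp: arcs_def)
      obtain p where p: "p \<in> points_on G s" "q = restrict \<phi> ?P p"
        using gluing_iso_points_on[OF r, of s] sq(3) unfolding bij_betw_def by blast
      then show "\<mu> a = push (restrict \<phi> ?P) a"
        using push_apply[OF r sq(2) p(1)] eq[of s p] sq P by (auto simp: arcs_def subset_iff)
    qed (use \<mu> in \<open>auto simp: arc_lengths_def push_def PiE_def\<close>)
    then show "\<mu> \<in> push ` gluing_isos S G G"
      using r by (auto simp: gluing_isos_def)
  qed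
  then show ?thesis using card_image[OF inj_push] by simp
qed

lemma coordinate_arcs_eq:
  "coordinate_arcs S G = (SIGMA s:S. points_on G s - {Min (points_on G s)})"
  by (auto simp: coordinate_arcs_def arcs_def)

text \<open>The omitted arc receives what the other arcs leave of the circle. Its nonnegativity is
  therefore the only constraint besides that of the coordinates themselves.\<close>

lemma image_coordinates:
  assumes G: "is_gluing S G" and ne: "\<And>s. s \<in> S \<Longrightarrow> points_on G s \<noteq> {}"
  shows "coordinates S G ` arc_lengths S len G =
    {x \<in> coordinate_arcs S G \<rightarrow>\<^sub>E {0..}.
       \<forall>s\<in>S. (\<Sum>p\<in>points_on G s - {Min (points_on G s)}. x (s, p)) \<le> len s}" (is "_ = ?D")
proof (intro equalityI subsetI)
  let ?Q = "\<lambda>s. points_on G s - {Min (points_on G s)}"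
  have Min: "Min (points_on G s) \<in> points_on G s" if "s \<in> S" for s
    using ne[OF that] finite_points_on[OF G] by simp
  have split: "(\<Sum>p\<in>points_on G s. f p) = f (Min (points_on G s)) + (\<Sum>p\<in>?Q s. f p)"
    if "s \<in> S" for s and f :: "nat \<Rightarrow> real"
    using sum.remove[OF finite_points_on[OF G] Min[OF that]] .
  {
    fix x assume "x \<in> coordinates S G ` arc_lengths S len G"
    then obtain \<alpha> where \<alpha>: "\<alpha> \<in> arc_lengths S len G" and x: "x = coordinates S G \<alpha>" by auto
    have "(\<Sum>p\<in>?Q s. x (s, p)) \<le> len s" if s: "s \<in> S" for s
    proof -
      have "(\<Sum>p\<in>?Q s. x (s, p)) = (\<Sum>p\<in>?Q s. \<alpha> (s, p))"
        using s by (intro sum.cong) (auto simp: x coordinates_def coordinate_arcs_eq)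
      moreover have "len s = (\<Sum>p\<in>points_on G s. \<alpha> (s, p))"
        using \<alpha> s ne by (auto simp: arc_lengths_def)
      moreover have "\<alpha> (s, Min (points_on G s)) \<ge> 0"
        using \<alpha> s Min[OF s] by (rule arc_lengths_nonneg)
      ultimately show ?thesis using split[OF s, of "\<lambda>p. \<alpha> (s, p)"] by simp
    qed
    moreover have "x \<in> coordinate_arcs S G \<rightarrow>\<^sub>E {0..}"
      using \<alpha> by (auto simp: x coordinates_def coordinate_arcs_eq arc_lengths_def arcs_def)
    ultimately show "x \<in> ?D" by simp
  }
  fix x assume x: "x \<in> ?D"
  define \<alpha> where "\<alpha> = (\<lambda>(s, p)\<in>arcs S G.
    if p = Min (points_on G s) then len s - (\<Sum>q\<in>?Q s. x (s, q)) else x (s, p))"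
  have "(\<Sum>p\<in>points_on G s. \<alpha> (s, p)) = len s" if s: "s \<in> S" for s
  proof -
    have "(\<Sum>p\<in>?Q s. \<alpha> (s, p)) = (\<Sum>p\<in>?Q s. x (s, p))"
      using s by (intro sum.cong) (auto simp: \<alpha>_def arcs_def)
    moreover have "\<alpha> (s, Min (points_on G s)) = len s - (\<Sum>q\<in>?Q s. x (s, q))"
      using s Min[OF s] by (auto simp: \<alpha>_def arcs_def)
    ultimately show ?thesis using split[OF s, of "\<lambda>p. \<alpha> (s, p)"] by simp
  qed
  moreover have "\<alpha> (s, p) \<ge> 0" if "s \<in> S" "p \<in> points_on G s" for s p
    using that x PiE_mem[of x "coordinate_arcs S G" "\<lambda>_. {0..}" "(s, p)"]
    by (auto simp: \<alpha>_def arcs_def coordinate_arcs_eq)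
  ultimately have "\<alpha> \<in> arc_lengths S len G"
    by (auto simp: arc_lengths_def arcs_def \<alpha>_def)
  moreover have "x = coordinates S G \<alpha>"
    using x by (intro extensionalityI[of _ "coordinate_arcs S G"])
      (auto simp: coordinates_def \<alpha>_def coordinate_arcs_eq arcs_def PiE_def)
  ultimately show "x \<in> coordinates S G ` arc_lengths S len G" by blast
qed


text \<open>The weight in the integral equals the reciprocal of the order of the automorphism group
  almost everywhere on the coordinate domain, and that domain is a product of simplices of dimension
  one less than the number of points on each circle.\<close>

lemma gluing_volume_eq:
  assumes S: "finite S" and G: "is_gluing S G" and ne: "\<And>s. s \<in> S \<Longrightarrow> points_on G s \<noteq> {}"
    and len: "\<And>s. s \<in> S \<Longrightarrow> len s \<ge> 0"
  shows "gluing_volume S len G =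
    (\<Prod>s\<in>S. len s ^ (card (points_on G s) - 1) / fact (card (points_on G s) - 1)) /
      card (gluing_isos S G G)"
proof -
  let ?Q = "\<lambda>s. points_on G s - {Min (points_on G s)}"
  let ?M = "\<Pi>\<^sub>M a \<in> coordinate_arcs S G. (lborel :: real measure)"
  define D where "D = coordinates S G ` arc_lengths S len G"
  define c where "c = 1 / real (card (gluing_isos S G G))"
  define V where
    "V = (\<Prod>s\<in>S. len s ^ (card (points_on G s) - 1) / fact (card (points_on G s) - 1))"
  have fin: "finite (points_on G s)" for s using finite_points_on[OF G] .
  have finC: "finite (coordinate_arcs S G)" unfolding coordinate_arcs_eq using S fin by auto
  have Min: "Min (points_on G s) \<in> points_on G s" if "s \<in> S" for s
    using ne[OF that] fin by simp
  have cardQ: "card (?Q s) = card (points_on G s) - 1" if "s \<in> S" for s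
    using Min[OF that] by simp
  have comp[measurable]: "(\<lambda>x. x (s, p)) \<in> borel_measurable ?M" if "s \<in> S" "p \<in> ?Q s" for s p
    using that by (auto intro!: measurable_component_singleton simp: coordinate_arcs_eq
        simp flip: measurable_lborel1)
  have D_eq: "D = {x \<in> coordinate_arcs S G \<rightarrow>\<^sub>E {0..}. \<forall>s\<in>S. (\<Sum>p\<in>?Q s. x (s, p)) \<le> len s}"
    unfolding D_def by (rule image_coordinates[OF G ne])
  have D: "D \<in> sets ?M" and "emeasure ?M D = ennreal (\<Prod>s\<in>S. len s ^ card (?Q s) / fact (card (?Q s)))"
    unfolding D_eq unfolding coordinate_arcs_eq
    using S fin len by (auto intro!: emeasure_PiM_Sigma_simplices)
  then have emD: "emeasure ?M D = ennreal V"
    using cardQ by (simp add: V_def cong: prod.cong)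
  txt \<open>Almost surely the arcs of each circle have distinct lengths; then the stabiliser is trivial.\<close>
  have "AE x in ?M. \<forall>s\<in>S. \<forall>p\<in>?Q s. \<forall>q\<in>?Q s. p \<noteq> q \<longrightarrow> x (s, p) - x (s, q) \<noteq> 0"
  proof (intro AE_ball_countable' countable_finite S finite_Diff fin)
    fix s p q assume s: "s \<in> S" and p: "p \<in> ?Q s" and q: "q \<in> ?Q s"
    show "AE x in ?M. p \<noteq> q \<longrightarrow> x (s, p) - x (s, q) \<noteq> 0"
    proof (cases "p = q")
      case False
      have "AE x in ?M. x (s, p) - x (s, q) \<noteq> 0"
        using s p q False comp[OF s p] comp[OF s q]
        by (intro AE_PiM_lborel_not_level_set[OF finC, of "(s, p)" 1] borel_measurable_diff)
          (auto simp: coordinate_arcs_eq)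
      then show ?thesis by simp
    qed simp
  qed
  \<comment> \<open>This excludes coincidences with the omitted arc, whose length is
    \<open>len s\<close> minus the sum of the coordinates on \<open>s\<close>.\<close>
  moreover have "AE x in ?M. \<forall>s\<in>S. \<forall>p\<in>?Q s. x (s, p) + (\<Sum>q\<in>?Q s. x (s, q)) \<noteq> len s"
  proof (intro AE_ball_countable' countable_finite S finite_Diff fin)
    fix s p assume s: "s \<in> S" and p: "p \<in> ?Q s"
    let ?f = "\<lambda>x. x (s, p) + (\<Sum>q\<in>?Q s. x (s, q))"
    \<comment> \<open>The slope is 2 because \<open>x (s, p)\<close> occurs both alone and inside
      the sum.\<close>
    have affine: "?f (x((s, p) := y)) = ?f (x((s, p) := 0)) + 2 * y"
      for x :: "circle \<times> nat \<Rightarrow> real" and y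
    proof -
      have "(\<Sum>q\<in>?Q s. (x((s, p) := y)) (s, q)) = y + (\<Sum>q\<in>?Q s - {p}. x (s, q))" for y
        using sum.remove[OF _ p, of "\<lambda>q. (x((s, p) := y)) (s, q)"] fin by simp
      from this[of y] this[of 0] show ?thesis by simp
    qed
    show "AE x in ?M. ?f x \<noteq> len s"
    proof (rule AE_PiM_lborel_not_level_set[OF finC _ _ _ affine])
      show "(s, p) \<in> coordinate_arcs S G" using s p by (auto simp: coordinate_arcs_eq)
      show "?f \<in> borel_measurable ?M"
        using comp[OF s] p by (intro borel_measurable_add borel_measurable_sum)
    qed simp
  qed
  ultimately have "AE x in ?M. ennreal (1 / real (card {\<mu> \<in> arc_lengths S len G.
         constellation_iso S (G, the_inv_into (arc_lengths S len G) (coordinates S G) x) (G, \<mu>)}))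
       * indicator D x = ennreal c * indicator D x"
  proof eventually_elim
    fix x
    assume x1: "\<forall>s\<in>S. \<forall>p\<in>?Q s. \<forall>q\<in>?Q s. p \<noteq> q \<longrightarrow> x (s, p) - x (s, q) \<noteq> 0"
      and x2: "\<forall>s\<in>S. \<forall>p\<in>?Q s. x (s, p) + (\<Sum>q\<in>?Q s. x (s, q)) \<noteq> len s"
    define \<alpha> where "\<alpha> = the_inv_into (arc_lengths S len G) (coordinates S G) x"
    have "card {\<mu> \<in> arc_lengths S len G. constellation_iso S (G, \<alpha>) (G, \<mu>)} =
        card (gluing_isos S G G)" if x: "x \<in> D"
    proof (rule card_constellation_orbit[OF G])
      show \<alpha>: "\<alpha> \<in> arc_lengths S len G"
        using the_inv_into_into[OF inj_on_coordinates[OF G] _ subset_refl, of x len] x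
        by (simp add: \<alpha>_def D_def)
      have x_eq: "x = coordinates S G \<alpha>"
        using f_the_inv_into_f[OF inj_on_coordinates[OF G], of x len] x
        by (simp add: \<alpha>_def D_def)
      fix s assume s: "s \<in> S"
      have coord: "\<alpha> (s, p) = x (s, p)" if "p \<in> ?Q s" for p
        using that s by (simp add: x_eq coordinates_def coordinate_arcs_eq)
      have omitted: "\<alpha> (s, Min (points_on G s)) = len s - (\<Sum>q\<in>?Q s. x (s, q))"
        using \<alpha> s ne sum.remove[OF fin Min[OF s], of "\<lambda>p. \<alpha> (s, p)"] coord
        by (simp add: arc_lengths_def)
      show "inj_on (\<lambda>p. \<alpha> (s, p)) (points_on G s)"
      proof (rule inj_onI, rule ccontr)
        fix p q assume pq: "p \<in> points_on G s" "q \<in> points_on G s" "\<alpha> (s, p) = \<alpha> (s, q)" "p \<noteq> q"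
        \<comment> \<open>Two arcs of equal length are either both coordinates or one of them is the
          omitted arc; the two null sets rule out these cases.\<close>
        consider "p \<in> ?Q s" "q \<in> ?Q s" | "p \<in> ?Q s" "q = Min (points_on G s)"
          | "q \<in> ?Q s" "p = Min (points_on G s)"
          using pq by blast
        then show False
        proof cases
          case 1
          then show ?thesis using x1 s pq coord by auto
        next
          case 2
          then have "x (s, p) + (\<Sum>q\<in>?Q s. x (s, q)) = len s"
            using pq(3) coord[of p] omitted by simp
          then show ?thesis using x2 s 2(1) by blast
        next
          case 3
          then have "x (s, q) + (\<Sum>q\<in>?Q s. x (s, q)) = len s"
            using pq(3) coord[of q] omitted by simp
          then show ?thesis using x2 s 3(1) by blast
        qed
      qed
    qed
    then show "ennreal (1 / real (card {\<mu> \<in> arc_lengths S len G.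
         constellation_iso S (G, the_inv_into (arc_lengths S len G) (coordinates S G) x) (G, \<mu>)}))
       * indicator D x = ennreal c * indicator D x"
      by (simp add: indicator_def c_def \<alpha>_def)
  qed
  then have "gluing_volume S len G = enn2real (\<integral>\<^sup>+ x. ennreal c * indicator D x \<partial>?M)"
    unfolding gluing_volume_def D_def[symmetric] by (intro arg_cong[of _ _ enn2real] nn_integral_cong_AE)
  also have "\<dots> = enn2real (ennreal c * ennreal V)"
    using D emD by (simp add: nn_integral_cmult_indicator)
  also have "\<dots> = c * V"
  proof -
    have "c \<ge> 0" "V \<ge> 0" using len by (simp_all add: c_def V_def prod_nonneg)
    then show ?thesis by (simp flip: ennreal_mult)
  qed
  finally show ?thesis by (simp add: c_def V_def)
qed

subsection \<open>Counting cyclic orders\<close>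

lemma card_extensional_bijections:
  assumes "finite A" "finite B" "card A = card B"
  shows "card {f \<in> A \<rightarrow>\<^sub>E B. bij_betw f A B} = fact (card A)"
proof -
  have "{f \<in> A \<rightarrow>\<^sub>E B. bij_betw f A B} = {f \<in> A \<rightarrow>\<^sub>E B. inj_on f A}"
  proof -
    have "bij_betw f A B" if "f \<in> A \<rightarrow>\<^sub>E B" "inj_on f A" for f
    proof -
      have "f ` A \<subseteq> B" "card (f ` A) = card B"
        using that assms card_image[of f A] by auto
      then show ?thesis
        using that assms card_subset_eq[of B "f ` A"] by (simp add: bij_betw_def)
    qed
    then show ?thesis by (auto simp: bij_betw_def)
  qed
  also have "card \<dots> = (\<Prod>i = 0..<card A. card A - i)"
    using card_inj_on_subset_funcset[OF assms(1,2) subset_refl] assms(3) by simp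
  finally show ?thesis by (simp add: fact_prod_rev)
qed

text \<open>Let \<open>m\<close> be the least positive time of return to \<open>a\<close>. The
  iterates before \<open>m\<close> are distinct and exhaust the orbit, which is \<open>A\<close>, so
  \<open>m = card A\<close>.\<close>

lemma funpow_bij_betw_cyclic_on:
  assumes f: "cyclic_on f A" and a: "a \<in> A"
  shows "bij_betw (\<lambda>i. (f ^^ i) a) {..<card A} A" "(f ^^ card A) a = a"
proof -
  have orb: "orbit f a = A" using orbit_cyclic_eq3[OF f a] .
  define m where "m = (LEAST m. 0 < m \<and> (f ^^ m) a = a)"
  have "\<exists>m. 0 < m \<and> (f ^^ m) a = a"
    using a orb unfolding orbit_altdef by force
  then have m: "0 < m" "(f ^^ m) a = a"
    unfolding m_def by (metis (mono_tags, lifting) LeastI)+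
  have least: "m \<le> j" if "0 < j" "(f ^^ j) a = a" for j
    unfolding m_def using that by (intro Least_le) simp
  have inj: "i = j" if "i \<le> j" "j < m" "(f ^^ i) a = (f ^^ j) a" for i j
  proof (rule ccontr)
    assume "i \<noteq> j"
    \<comment> \<open>If the iterates at \<open>i < j\<close> agreed, then \<open>m - j\<close>
      further steps would return to \<open>a\<close> after only \<open>m - j + i < m\<close> steps
      in all.\<close>
    have "(f ^^ (m - j + i)) a = (f ^^ (m - j)) ((f ^^ i) a)" by (simp add: funpow_add)
    also have "\<dots> = (f ^^ (m - j + j)) a" using that(3) by (simp add: funpow_add)
    also have "\<dots> = a" using that m by simp
    finally show False using least[of "m - j + i"] that \<open>i \<noteq> j\<close> by simp
  qed
  have "inj_on (\<lambda>i. (f ^^ i) a) {..<m}"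
    using inj by (intro linorder_inj_onI) (auto, metis less_imp_le less_irrefl)
  moreover have "(\<lambda>i. (f ^^ i) a) ` {..<m} = A"
    using orbit_altdef_bounded[OF m(2,1)] orb by auto
  ultimately have b: "bij_betw (\<lambda>i. (f ^^ i) a) {..<m} A" by (simp add: bij_betw_def)
  then have "card A = m" using bij_betw_same_card by fastforce
  then show "bij_betw (\<lambda>i. (f ^^ i) a) {..<card A} A" "(f ^^ card A) a = a"
    using b m by auto
qed

text \<open>A cyclic map together with a starting point amounts to an enumeration of
  \<open>A\<close> by \<open>{..<card A}\<close>. There are \<open>n!\<close> enumerations and
  \<open>n\<close> starting points for each map, where \<open>n = card A\<close>.\<close>

lemma card_cyclic_on:
  fixes A :: "'a set"
  assumes fin: "finite A" and ne: "A \<noteq> {}"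
  shows "card {f \<in> extensional A. cyclic_on f A} = fact (card A - 1)" (is "card ?C = _")
proof -
  define n where "n = card A"
  have n: "n > 0" using assms by (simp add: n_def card_gt_0_iff)
  define F :: "('a \<Rightarrow> 'a) \<times> 'a \<Rightarrow> nat \<Rightarrow> 'a" where "F = (\<lambda>(f, a :: 'a). \<lambda>i\<in>{..<n}. (f ^^ i) a)"
  have "bij_betw F (?C \<times> A) {h \<in> {..<n} \<rightarrow>\<^sub>E A. bij_betw h {..<n} A}"
  proof (intro bij_betw_imageI equalityI subsetI inj_onI)
    fix u v assume u: "u \<in> ?C \<times> A" and v: "v \<in> ?C \<times> A" and eq: "F u = F v"
    obtain f a g b where uv: "u = (f, a)" "v = (g, b)" by fastforce
    have "a = b" using fun_cong[OF eq, of 0] n by (simp add: F_def uv)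
    \<comment> \<open>\<open>F\<close> records the iterates below \<open>n\<close> only. The
      \<open>n\<close>-th one, which is the successor of the last point, is the starting point for
      both maps.\<close>
    have pow: "(f ^^ i) a = (g ^^ i) b" if "i \<le> n" for i
    proof (cases "i = n")
      case True
      then show ?thesis
        using u v funpow_bij_betw_cyclic_on(2)[of f A a] funpow_bij_betw_cyclic_on(2)[of g A b] \<open>a = b\<close>
        by (simp add: uv n_def)
    next
      case False
      then show ?thesis using fun_cong[OF eq, of i] that by (simp add: F_def uv)
    qed
    have "f = g"
    proof (rule extensionalityI[of _ A])
      fix x assume "x \<in> A"
      then obtain i where i: "i < n" "x = (f ^^ i) a"
        using u funpow_bij_betw_cyclic_on(1)[of f A a] by (auto simp: uv n_def bij_betw_def)
      then show "f x = g x" using pow[of i] pow[of "Suc i"] by simp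
    qed (use u v uv in auto)
    then show "u = v" using \<open>a = b\<close> uv by simp
  next
    fix h assume "h \<in> F ` (?C \<times> A)"
    then obtain f a where fa: "cyclic_on f A" "a \<in> A" and h: "h = F (f, a)" by auto
    have b: "bij_betw (\<lambda>i. (f ^^ i) a) {..<n} A"
      using funpow_bij_betw_cyclic_on(1)[OF fa] by (simp add: n_def)
    then have "bij_betw h {..<n} A"
      unfolding h F_def by (simp add: bij_betw_restrict_eq)
    then show "h \<in> {h \<in> {..<n} \<rightarrow>\<^sub>E A. bij_betw h {..<n} A}"
      using bij_betwE[OF b] by (auto simp: h F_def)
  next
    fix h assume "h \<in> {h \<in> {..<n} \<rightarrow>\<^sub>E A. bij_betw h {..<n} A}"
    then have hE: "h \<in> {..<n} \<rightarrow>\<^sub>E A" and h: "bij_betw h {..<n} A" by auto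
    \<comment> \<open>The map that advances by one in the enumeration \<open>h\<close>, with the
      last element followed by the first.\<close>
    define f where "f = (\<lambda>x\<in>A. h (Suc (the_inv_into {..<n} h x) mod n))"
    have fh: "f (h i) = h (Suc i mod n)" if "i < n" for i
      using h that by (auto simp: f_def bij_betw_def the_inv_into_f_f)
    have pow: "(f ^^ i) (h 0) = h (i mod n)" for i
      by (induction i) (simp_all add: fh n mod_Suc_eq)
    have h0: "h 0 \<in> A" using bij_betwE[OF h] n by auto
    have "A = orbit f (h 0)"
    proof (intro equalityI subsetI)
      fix x assume "x \<in> A"
      then obtain i where "i < n" "x = h i" using h by (auto simp: bij_betw_def)
      \<comment> \<open>An orbit consists of positive iterates; the extra turn \<open>n\<close>
        takes care of \<open>i = 0\<close>.\<close>
      then have "x = (f ^^ (i + n)) (h 0)" "0 < i + n" using n unfolding pow by auto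
      then show "x \<in> orbit f (h 0)" unfolding orbit_altdef by blast
    next
      fix x assume "x \<in> orbit f (h 0)"
      then obtain i where "x = h (i mod n)" unfolding orbit_altdef pow by auto
      then show "x \<in> A" using bij_betwE[OF h] n by auto
    qed
    then have "f \<in> ?C" using h0 by (auto simp: cyclic_on_def f_def)
    moreover have "h = F (f, h 0)"
      using hE by (intro extensionalityI[of _ "{..<n}"]) (auto simp: F_def pow PiE_def)
    ultimately show "h \<in> F ` (?C \<times> A)" using h0 by blast
  qed
  then have "card (?C \<times> A) = card {h \<in> {..<n} \<rightarrow>\<^sub>E A. bij_betw h {..<n} A}"
    by (rule bij_betw_same_card)
  also have "\<dots> = fact n"
    using card_extensional_bijections[of "{..<n}" A] fin by (simp add: n_def)
  finally have "card ?C * n = fact (n - 1) * n"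
    using n by (simp add: card_cartesian_product n_def fact_reduce[of "card A"] mult.commute)
  then show ?thesis using n by (simp add: n_def)
qed

subsection \<open>Labelled gluings\<close>

lemma gluing_iso_trans:
  assumes "gluing_iso S \<phi> G H" "gluing_iso S \<psi> H K"
  shows "gluing_iso S (\<psi> \<circ> \<phi>) G K"
proof -
  have "\<phi> p \<in> gluing_points H" if "p \<in> gluing_points G" for p
    using assms that by (auto simp: gluing_iso_def bij_betw_def)
  then show ?thesis
    using assms by (auto simp: gluing_iso_def points_on_def intro: bij_betw_trans)
qed

lemma finite_gluing_isos:
  assumes "is_gluing S G" "is_gluing S H"
  shows "finite (gluing_isos S G H)"
proof (rule finite_subset)
  show "gluing_isos S G H \<subseteq> gluing_points G \<rightarrow>\<^sub>E gluing_points H"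
    by (auto simp: gluing_isos_def gluing_iso_def bij_betw_def PiE_def)
  show "finite (gluing_points G \<rightarrow>\<^sub>E gluing_points H)"
    using assms by (intro finite_PiE) (auto simp: is_gluing_def)
qed

text \<open>Composition with an isomorphism from \<open>H\<close> to \<open>K\<close> is injective
  on isomorphisms. Used in both directions, this shows that a gluing has as many isomorphisms to any
  gluing of its type as automorphisms.\<close>

lemma card_gluing_isos_le:
  assumes G: "is_gluing S G" and HK: "(H, K) \<in> same_type S"
  shows "card (gluing_isos S G H) \<le> card (gluing_isos S G K)"
proof -
  obtain \<psi> where \<psi>: "gluing_iso S \<psi> H K" and K: "is_gluing S K"
    using HK by (auto simp: same_type_def)
  have inj: "inj_on \<psi> (gluing_points H)" using \<psi> by (auto simp: gluing_iso_def bij_betw_def)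
  define F where "F \<phi> = restrict (\<psi> \<circ> \<phi>) (gluing_points G)" for \<phi>
  have "inj_on F (gluing_isos S G H)"
  proof (rule inj_onI)
    fix f g assume fg: "f \<in> gluing_isos S G H" "g \<in> gluing_isos S G H" and eq: "F f = F g"
    show "f = g"
    proof (rule extensionalityI[of _ "gluing_points G"])
      fix p assume p: "p \<in> gluing_points G"
      then have "\<psi> (f p) = \<psi> (g p)" using fun_cong[OF eq, of p] by (simp add: F_def)
      moreover have "f p \<in> gluing_points H" "g p \<in> gluing_points H"
        using fg p by (auto simp: gluing_isos_def gluing_iso_def bij_betw_def)
      ultimately show "f p = g p" using inj by (auto dest: inj_onD)
    qed (use fg in \<open>auto simp: gluing_isos_def\<close>)
  qed
  moreover have "F ` gluing_isos S G H \<subseteq> gluing_isos S G K"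
    using gluing_iso_trans[OF _ \<psi>] by (auto simp: gluing_isos_def F_def gluing_iso_restrict[OF G])
  ultimately show ?thesis
    using finite_gluing_isos[OF G K] by (rule card_inj_on_le)
qed

lemma card_gluing_isos_eq:
  assumes "(G, H) \<in> same_type S"
  shows "card (gluing_isos S G H) = card (gluing_isos S G G)"
proof -
  have "is_gluing S G" "(H, G) \<in> same_type S"
    using assms equiv_same_type[of S] by (auto simp: same_type_def equiv_def dest: symD)
  then show ?thesis using assms card_gluing_isos_le by (metis antisym)
qed

text \<open>The edges of the complete multipartite graph on \<open>S\<close> whose parts are the
  colour classes.\<close>

definition simple_pairs :: "circle set \<Rightarrow> circle set set" where
  "simple_pairs S = {e. e \<subseteq> S \<and> card e = 2 \<and> inj_on colour e}"

definition simple_gluing :: "circle set \<Rightarrow> gluing \<Rightarrow> bool" where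
  "simple_gluing S G \<longleftrightarrow> is_gluing S G \<and> (\<forall>s \<in> S. \<not> isolated G s) \<and> no_three_share G"

text \<open>
  The extensionality conditions fix all irrelevant values, so that a labelled gluing is determined by
  its isomorphism from any given gluing.
\<close>

definition labelled_gluings :: "circle set \<Rightarrow> nat \<Rightarrow> gluing set" where
  "labelled_gluings S n = {G. gluing_points G = {..<n} \<and>
     circles_at G \<in> {..<n} \<rightarrow>\<^sub>E simple_pairs S \<and>
     (\<forall>s\<in>S. points_on G s \<noteq> {}) \<and>
     next_point G \<in> (\<Pi>\<^sub>E s\<in>S. {f \<in> extensional (points_on G s). cyclic_on f (points_on G s)})}"

lemma simple_gluing_pairs:
  assumes "simple_gluing S G" "p \<in> gluing_points G"
  shows "circles_at G p \<in> simple_pairs S"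
proof -
  have "circles_at G p \<subseteq> S" "card (circles_at G p) \<ge> 2" "inj_on colour (circles_at G p)"
    "card (circles_at G p) < 3"
    using assms unfolding simple_gluing_def is_gluing_def no_three_share_def by blast+
  then show ?thesis by (simp add: simple_pairs_def)
qed

lemma labelled_gluings_simple:
  assumes "G \<in> labelled_gluings S n"
  shows "simple_gluing S G"
proof -
  have "circles_at G p \<in> simple_pairs S" if "p < n" for p
    using assms that by (auto simp: labelled_gluings_def)
  then show ?thesis
    using assms
    by (auto simp: simple_gluing_def labelled_gluings_def is_gluing_def isolated_def
        no_three_share_def simple_pairs_def Pi_iff PiE_iff)
qed

text \<open>Lets the condition on all members of a class in \<open>simple_types\<close> be checked
  on one representative.\<close>

lemma simple_gluing_iso:
  assumes "simple_gluing S G" "(G, H) \<in> same_type S"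
  shows "simple_gluing S H"
proof -
  obtain \<phi> where \<phi>: "gluing_iso S \<phi> G H" and H: "is_gluing S H"
    using assms(2) by (auto simp: same_type_def)
  have "\<not> isolated H s" if "s \<in> S" for s
    using assms(1) that gluing_iso_points_on[OF \<phi>, of s]
    by (auto simp: simple_gluing_def isolated_def bij_betw_def)
  moreover have "no_three_share H"
    unfolding no_three_share_def
  proof
    fix q assume "q \<in> gluing_points H"
    then obtain p where "p \<in> gluing_points G" "q = \<phi> p"
      using \<phi> unfolding gluing_iso_def bij_betw_def by blast
    then show "card (circles_at H q) < 3"
      using assms(1) \<phi> by (simp add: simple_gluing_def no_three_share_def gluing_iso_def)
  qed
  ultimately show ?thesis using H by (simp add: simple_gluing_def)
qed

text \<open>Transport of structure along the numbering \<open>\<beta>\<close>.\<close>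

lemma labelled_gluing_ex:
  assumes G: "simple_gluing S G" and \<beta>: "bij_betw \<beta> (gluing_points G) {..<n}"
  shows "\<exists>H \<in> labelled_gluings S n. gluing_iso S \<beta> G H"
proof -
  let ?P = "gluing_points G"
  define \<gamma> where "\<gamma> = the_inv_into ?P \<beta>"
  have g: "is_gluing S G" using G by (simp add: simple_gluing_def)
  have \<gamma>\<beta>: "\<gamma> (\<beta> p) = p" if "p \<in> ?P" for p
    using \<beta> that by (simp add: \<gamma>_def bij_betw_def the_inv_into_f_f)
  have \<gamma>: "\<gamma> q \<in> ?P" "\<beta> (\<gamma> q) = q" if "q < n" for q
    using \<beta> that f_the_inv_into_f_bij_betw[OF \<beta>, of q] bij_betwE[OF bij_betw_the_inv_into[OF \<beta>]]
    by (auto simp: \<gamma>_def)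
  \<comment> \<open>The restrictions supply the extensionality that \<open>labelled_gluings\<close>
    demands.\<close>
  define H where "H = \<lparr>gluing_points = {..<n}, circles_at = (\<lambda>q\<in>{..<n}. circles_at G (\<gamma> q)),
    next_point = (\<lambda>s\<in>S. \<lambda>q\<in>\<beta> ` points_on G s. \<beta> (next_point G s (\<gamma> q)))\<rparr>"
  have P: "points_on G s \<subseteq> ?P" for s by (auto simp: points_on_def)
  have \<beta>P: "\<beta> p < n" if "p \<in> ?P" for p using bij_betwE[OF \<beta>] that by auto
  have pts: "points_on H s = \<beta> ` points_on G s" for s
  proof -
    have "q \<in> \<beta> ` points_on G s" if "q < n" "s \<in> circles_at G (\<gamma> q)" for q
      using \<gamma>[OF that(1)] that(2) by (intro image_eqI[of _ _ "\<gamma> q"]) (auto simp: points_on_def)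
    then show ?thesis
      by (auto simp: points_on_def H_def \<gamma>\<beta> \<beta>P)
  qed
  have "gluing_iso S \<beta> G H"
    using \<beta> \<beta>P P \<gamma>\<beta> by (auto simp: gluing_iso_def H_def subset_iff)
  moreover have "H \<in> labelled_gluings S n"
    unfolding labelled_gluings_def
  proof (intro CollectI conjI ballI)
    show "circles_at H \<in> {..<n} \<rightarrow>\<^sub>E simple_pairs S"
      using simple_gluing_pairs[OF G] \<gamma>(1) by (auto simp: H_def)
    show "points_on H s \<noteq> {}" if "s \<in> S" for s
      using G that by (auto simp: pts simple_gluing_def isolated_def)
    have "cyclic_on (next_point H s) (\<beta> ` points_on G s)" if s: "s \<in> S" for s
    proof (rule cyclic_on_image)
      show "cyclic_on (next_point G s) (points_on G s)"
        using G s by (auto simp: simple_gluing_def isolated_def is_gluing_def)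
      show "next_point H s (\<beta> p) = \<beta> (next_point G s p)" if "p \<in> points_on G s" for p
        using that s P \<gamma>\<beta> by (auto simp: H_def subset_iff)
    qed
    then show "next_point H \<in>
        (\<Pi>\<^sub>E s\<in>S. {f \<in> extensional (points_on H s). cyclic_on f (points_on H s)})"
      unfolding pts by (auto simp: H_def PiE_iff)
  qed (simp add: H_def)
  ultimately show ?thesis by blast
qed

text \<open>The isomorphism \<open>\<beta>\<close> dictates the incidences and successors at all
  numbered points, and extensionality fixes all other values.\<close>

lemma labelled_gluing_unique:
  assumes H: "H \<in> labelled_gluings S n" and K: "K \<in> labelled_gluings S n"
    and h: "gluing_iso S \<beta> G H" and k: "gluing_iso S \<beta> G K"
  shows "H = K"
proof -
  have pts: "gluing_points H = {..<n}" "gluing_points K = {..<n}"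
    using H K by (auto simp: labelled_gluings_def)
  have b: "bij_betw \<beta> (gluing_points G) {..<n}" using h pts by (simp add: gluing_iso_def)
  have "circles_at H = circles_at K"
  proof (rule extensionalityI[of _ "{..<n}"])
    fix q assume "q \<in> {..<n}"
    then obtain p where "p \<in> gluing_points G" "q = \<beta> p" using b by (auto simp: bij_betw_def)
    then show "circles_at H q = circles_at K q" using h k by (simp add: gluing_iso_def)
  qed (use H K in \<open>auto simp: labelled_gluings_def PiE_def\<close>)
  moreover from this have on: "points_on H s = points_on K s" for s
    by (simp add: points_on_def pts)
  have "next_point H = next_point K"
  proof (rule extensionalityI[of _ S])
    fix s assume s: "s \<in> S"
    show "next_point H s = next_point K s"
    proof (rule extensionalityI[of _ "points_on H s"])
      fix q assume "q \<in> points_on H s"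
      then obtain p where "p \<in> points_on G s" "q = \<beta> p"
        using gluing_iso_points_on[OF h, of s] by (auto simp: bij_betw_def)
      then show "next_point H s q = next_point K s q" using h k s by (simp add: gluing_iso_def)
    qed (use H K s on in \<open>auto simp: labelled_gluings_def PiE_iff\<close>)
  qed (use H K in \<open>auto simp: labelled_gluings_def PiE_def\<close>)
  ultimately show ?thesis using pts by (intro gluing.equality) auto
qed

lemma simple_types_eq:
  "simple_types S = {C \<in> topological_types S. \<forall>G \<in> C. simple_gluing S G}"
proof -
  have "is_gluing S G" if "C \<in> topological_types S" "G \<in> C" for C G
    using that in_quotient_imp_subset[OF equiv_same_type] by (auto simp: topological_types_def)
  then show ?thesis by (auto simp: simple_types_def simple_gluing_def)
qed

lemma simple_types_class:
  assumes "simple_gluing S G"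
  shows "same_type S `` {G} \<in> simple_types S"
proof -
  have "is_gluing S G" using assms by (simp add: simple_gluing_def)
  then show ?thesis
    using assms simple_gluing_iso by (auto simp: simple_types_eq topological_types_def intro: quotientI)
qed

lemma simple_types_memD:
  assumes "C \<in> simple_types S" "G \<in> C"
  shows "simple_gluing S G" "C = same_type S `` {G}"
proof -
  show "simple_gluing S G" using assms by (simp add: simple_types_eq)
  have "C \<in> {G. is_gluing S G} // same_type S"
    using assms by (simp add: simple_types_eq topological_types_def)
  then show "C = same_type S `` {G}"
    using assms(2) by (metis Image_singleton_iff equiv_class_eq equiv_same_type quotientE)
qed

text \<open>Equivalence classes are non-empty, so the representative chosen in
  \<open>type_volume\<close> is a genuine member.\<close>

lemma simple_types_some:
  assumes "C \<in> simple_types S"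
  shows "(SOME G. G \<in> C) \<in> C"
proof -
  have "C \<noteq> {}"
    using assms in_quotient_imp_non_empty[OF equiv_same_type]
    by (auto simp: simple_types_eq topological_types_def)
  then show ?thesis by (simp add: some_in_eq)
qed

lemma card_gluing_points_iso:
  assumes "(G, H) \<in> same_type S"
  shows "card (gluing_points G) = card (gluing_points H)"
    "card (points_on G s) = card (points_on H s)"
proof -
  obtain \<phi> where \<phi>: "gluing_iso S \<phi> G H" using assms by (auto simp: same_type_def)
  then show "card (gluing_points G) = card (gluing_points H)"
    by (auto simp: gluing_iso_def intro: bij_betw_same_card)
  show "card (points_on G s) = card (points_on H s)"
    using gluing_iso_points_on[OF \<phi>] by (rule bij_betw_same_card)
qed

section \<open>Counting labelled gluings and summing volumes over types\<close>

lemma finite_simple_pairs: "finite S \<Longrightarrow> finite (simple_pairs S)"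
  by (rule finite_subset[of _ "Pow S"]) (auto simp: simple_pairs_def)

text \<open>The \<open>n!\<close> numberings of the points of \<open>G\<close> are grouped by the
  labelled gluing they produce. Each group consists of the isomorphisms from \<open>G\<close> to
  that gluing and so has the size of the automorphism group.\<close>

lemma card_labelled_gluings_of_type:
  assumes C: "C \<in> simple_types S" and G: "G \<in> C" and n: "card (gluing_points G) = n"
    and fin: "finite (labelled_gluings S n)"
  shows "card (labelled_gluings S n \<inter> C) * card (gluing_isos S G G) = fact n"
proof -
  have sG: "simple_gluing S G" and C_eq: "C = same_type S `` {G}"
    using simple_types_memD[OF C G] .
  have g: "is_gluing S G" and finP: "finite (gluing_points G)"
    using sG by (auto simp: simple_gluing_def is_gluing_def)
  let ?L = "labelled_gluings S n \<inter> C"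
  txt \<open>Every numbering of the points of \<open>G\<close> is an isomorphism onto exactly one labelled gluing.\<close>
  have "(\<Union>H\<in>?L. gluing_isos S G H) =
      {f \<in> gluing_points G \<rightarrow>\<^sub>E {..<n}. bij_betw f (gluing_points G) {..<n}}" (is "?U = ?B")
  proof (intro equalityI subsetI)
    fix f assume "f \<in> ?U"
    then obtain H where H: "H \<in> labelled_gluings S n" "f \<in> gluing_isos S G H" by auto
    then have "bij_betw f (gluing_points G) {..<n}"
      by (auto simp: gluing_isos_def gluing_iso_def labelled_gluings_def)
    then show "f \<in> ?B" using H by (auto simp: gluing_isos_def PiE_def bij_betw_def)
  next
    fix f assume f: "f \<in> ?B"
    then obtain H where H: "H \<in> labelled_gluings S n" "gluing_iso S f G H"
      using labelled_gluing_ex[OF sG] by blast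
    moreover have "H \<in> C"
      using H g labelled_gluings_simple[OF H(1)] by (auto simp: C_eq same_type_def simple_gluing_def)
    ultimately show "f \<in> ?U" using f by (auto simp: gluing_isos_def PiE_def)
  qed
  then have "fact n = card ?U"
    using card_extensional_bijections[of "gluing_points G" "{..<n}"] finP n by simp
  also have "\<dots> = (\<Sum>H\<in>?L. card (gluing_isos S G H))"
  proof (rule card_UN_disjoint)
    show "finite ?L" using fin by simp
    show "\<forall>H\<in>?L. finite (gluing_isos S G H)"
      using finite_gluing_isos[OF g] labelled_gluings_simple by (auto simp: simple_gluing_def)
    show "\<forall>H\<in>?L. \<forall>K\<in>?L. H \<noteq> K \<longrightarrow> gluing_isos S G H \<inter> gluing_isos S G K = {}"
      using labelled_gluing_unique by (fastforce simp: gluing_isos_def)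
  qed
  also have "\<dots> = (\<Sum>H\<in>?L. card (gluing_isos S G G))"
    by (intro sum.cong refl card_gluing_isos_eq) (auto simp: C_eq)
  finally show ?thesis by simp
qed

definition types_with :: "circle set \<Rightarrow> nat \<Rightarrow> gluing set set" where
  "types_with S n = {C \<in> simple_types S. \<forall>G\<in>C. card (gluing_points G) = n}"

text \<open>Every type with \<open>n\<close> points has a representative on \<open>{..<n}\<close>.
  This yields finiteness and allows sums over labelled gluings to be grouped by type.\<close>

lemma types_with_eq:
  "types_with S n = (\<lambda>G. same_type S `` {G}) ` labelled_gluings S n"
proof (intro equalityI subsetI)
  fix C assume "C \<in> types_with S n"
  then have C: "C \<in> simple_types S" and n: "\<And>G. G \<in> C \<Longrightarrow> card (gluing_points G) = n"
    by (auto simp: types_with_def)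
  obtain G where G: "G \<in> C" using simple_types_some[OF C] by blast
  have sG: "simple_gluing S G" and C_eq: "C = same_type S `` {G}"
    using simple_types_memD[OF C G] .
  have "finite (gluing_points G)" using sG by (simp add: simple_gluing_def is_gluing_def)
  then obtain \<beta> where "bij_betw \<beta> (gluing_points G) {..<n}"
    using n[OF G] ex_bij_betw_finite_nat atLeast0LessThan by metis
  then obtain H where H: "H \<in> labelled_gluings S n" "gluing_iso S \<beta> G H"
    using labelled_gluing_ex[OF sG] by blast
  then have "H \<in> C"
    using sG labelled_gluings_simple[OF H(1)] by (auto simp: C_eq same_type_def simple_gluing_def)
  then show "C \<in> (\<lambda>G. same_type S `` {G}) ` labelled_gluings S n"
    using simple_types_memD[OF C] H by blast
next
  fix C assume "C \<in> (\<lambda>G. same_type S `` {G}) ` labelled_gluings S n"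
  then obtain G where G: "G \<in> labelled_gluings S n" and C: "C = same_type S `` {G}" by auto
  have "card (gluing_points G) = n" using G by (simp add: labelled_gluings_def)
  then show "C \<in> types_with S n"
    using simple_types_class[OF labelled_gluings_simple[OF G]] card_gluing_points_iso(1)[of G _ S]
    by (auto simp: types_with_def C)
qed

text \<open>Splits a labelled gluing into its incidence map \<open>c\<close> and a choice of cyclic
  order on each circle. The absence of isolated circles becomes the condition that the values of
  \<open>c\<close> cover \<open>S\<close>.\<close>

lemma labelled_gluings_eq:
  "labelled_gluings S n = (\<lambda>(c, N). \<lparr>gluing_points = {..<n}, circles_at = c, next_point = N\<rparr>) `
     (SIGMA c:{c \<in> {..<n} \<rightarrow>\<^sub>E simple_pairs S. \<Union> (c ` {..<n}) = S}.
        \<Pi>\<^sub>E s\<in>S. {f \<in> extensional {p. p < n \<and> s \<in> c p}. cyclic_on f {p. p < n \<and> s \<in> c p}})"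
  (is "_ = ?g ` ?R")
proof (intro equalityI subsetI)
  fix G assume G: "G \<in> labelled_gluings S n"
  have pts: "points_on G s = {p. p < n \<and> s \<in> circles_at G p}" for s
    using G by (auto simp: labelled_gluings_def points_on_def)
  have c: "circles_at G p \<subseteq> S" if "p < n" for p
    using G that by (auto simp: labelled_gluings_def simple_pairs_def)
  have "\<Union> (circles_at G ` {..<n}) = S"
    using G c by (fastforce simp: labelled_gluings_def pts)
  then have "(circles_at G, next_point G) \<in> ?R"
    using G by (simp add: labelled_gluings_def pts)
  moreover have "G = ?g (circles_at G, next_point G)"
    using G by (simp add: labelled_gluings_def)
  ultimately show "G \<in> ?g ` ?R" by blast
next
  fix G assume "G \<in> ?g ` ?R"
  then obtain c N where cN: "(c, N) \<in> ?R" and G: "G = ?g (c, N)" by auto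
  have pts: "points_on G s = {p. p < n \<and> s \<in> c p}" for s
    by (auto simp: G points_on_def)
  have "points_on G s \<noteq> {}" if "s \<in> S" for s
    using cN that by (auto simp: pts)
  then show "G \<in> labelled_gluings S n"
    using cN by (simp add: labelled_gluings_def pts) (simp add: G)
qed

lemma finite_cyclic_maps:
  assumes "finite A"
  shows "finite {f \<in> extensional A. cyclic_on f A}"
proof (rule finite_subset[of _ "A \<rightarrow>\<^sub>E A"])
  show "{f \<in> extensional A. cyclic_on f A} \<subseteq> A \<rightarrow>\<^sub>E A"
    by (auto simp: PiE_def intro: cyclic_on_inI)
qed (use assms in \<open>auto intro: finite_PiE\<close>)

lemma finite_coverings: "finite S \<Longrightarrow> finite {c \<in> {..<n::nat} \<rightarrow>\<^sub>E simple_pairs S. \<Union> (c ` {..<n}) = S}"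
  using finite_PiE[of "{..<n}" "\<lambda>_. simple_pairs S"] finite_simple_pairs by simp

lemma finite_labelled_gluings:
  assumes "finite S"
  shows "finite (labelled_gluings S n)"
  unfolding labelled_gluings_eq using assms
  by (intro finite_imageI finite_SigmaI finite_coverings finite_PiE finite_cyclic_maps) auto

text \<open>The volume of the coordinate domain, before division by the order of the automorphism
  group.\<close>

definition simplices_volume :: "circle set \<Rightarrow> (circle \<Rightarrow> real) \<Rightarrow> gluing \<Rightarrow> real" where
  "simplices_volume S len G =
     (\<Prod>s\<in>S. len s ^ (card (points_on G s) - 1) / fact (card (points_on G s) - 1))"

text \<open>The summand depends on the incidences alone, and the number of cyclic orders on each
  circle cancels the factorial in the volume of its simplex.\<close>

lemma sum_labelled_gluings:
  assumes S: "finite S"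
  shows "(\<Sum>G\<in>labelled_gluings S n. simplices_volume S len G) =
    (\<Sum>c | c \<in> {..<n} \<rightarrow>\<^sub>E simple_pairs S \<and> \<Union> (c ` {..<n}) = S.
       \<Prod>s\<in>S. len s ^ (card {p. p < n \<and> s \<in> c p} - 1))"
proof -
  let ?K = "{c \<in> {..<n} \<rightarrow>\<^sub>E simple_pairs S. \<Union> (c ` {..<n}) = S}"
  let ?p = "\<lambda>c s. {p. p < n \<and> s \<in> c p}"
  let ?N = "\<lambda>c. \<Pi>\<^sub>E s\<in>S. {f \<in> extensional (?p c s). cyclic_on f (?p c s)}"
  let ?g = "\<lambda>(c, N). \<lparr>gluing_points = {..<n}, circles_at = c, next_point = N\<rparr>"
  let ?v = "\<lambda>c. \<Prod>s\<in>S. len s ^ (card (?p c s) - 1) / fact (card (?p c s) - 1)"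
  have "(\<Sum>G\<in>labelled_gluings S n. simplices_volume S len G) =
      (\<Sum>(c, N)\<in>Sigma ?K ?N. ?v c)"
    unfolding labelled_gluings_eq
    by (subst sum.reindex) (auto intro!: inj_onI sum.cong simp: simplices_volume_def points_on_def)
  also have "\<dots> = (\<Sum>c\<in>?K. \<Sum>N\<in>?N c. ?v c)"
    using S by (intro sum.Sigma[symmetric] finite_coverings ballI finite_PiE finite_cyclic_maps) auto
  also have "\<dots> = (\<Sum>c\<in>?K. \<Prod>s\<in>S. len s ^ (card (?p c s) - 1))"
  proof (intro sum.cong refl)
    fix c assume c: "c \<in> ?K"
    have "card (?N c) = (\<Prod>s\<in>S. card {f \<in> extensional (?p c s). cyclic_on f (?p c s)})"
      using S by (rule card_PiE)
    \<comment> \<open>The covering condition provides the non-empty point sets that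
      \<open>card_cyclic_on\<close> requires.\<close>
    also have "\<dots> = (\<Prod>s\<in>S. fact (card (?p c s) - 1))"
      using c by (intro prod.cong refl card_cyclic_on) auto
    finally show "(\<Sum>N\<in>?N c. ?v c) = (\<Prod>s\<in>S. len s ^ (card (?p c s) - 1))"
      by (simp flip: prod.distrib)
  qed
  finally show ?thesis by simp
qed

text \<open>A type is met \<open>n!\<close> divided by the order of its automorphism group times
  among the labelled gluings, and its volume carries the same divisor; the group order thus
  cancels.\<close>

lemma sum_types_with:
  assumes S: "finite S" and len: "\<And>s. s \<in> S \<Longrightarrow> len s \<ge> 0"
  shows "(\<Sum>C\<in>types_with S n. type_volume S len C) =
    (\<Sum>G\<in>labelled_gluings S n. simplices_volume S len G) / fact n"
proof -
  let ?L = "labelled_gluings S n" and ?g = "\<lambda>G. same_type S `` {G}"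
  have finL: "finite ?L" using finite_labelled_gluings[OF S] .
  have "(\<Sum>H | H \<in> ?L \<and> ?g H = C. simplices_volume S len H) = fact n * type_volume S len C"
    if C: "C \<in> types_with S n" for C
  proof -
    define G where "G = (SOME G. G \<in> C)"
    have sC: "C \<in> simple_types S" using C by (simp add: types_with_def)
    have G: "G \<in> C" unfolding G_def using simple_types_some[OF sC] .
    have sG: "simple_gluing S G" and C_eq: "C = ?g G" using simple_types_memD[OF sC G] .
    have g: "is_gluing S G" using sG by (simp add: simple_gluing_def)
    have n: "card (gluing_points G) = n" using C G by (simp add: types_with_def)
    have "{H. H \<in> ?L \<and> ?g H = C} = ?L \<inter> C"
    proof -
      have "H \<in> ?g H" if "H \<in> ?L" for H
        using labelled_gluings_simple[OF that] equiv_class_self[OF equiv_same_type, of H S]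
        by (simp add: simple_gluing_def)
      then show ?thesis using simple_types_memD(2)[OF sC] by blast
    qed
    moreover have "simplices_volume S len H = simplices_volume S len G" if "H \<in> C" for H
      using that card_gluing_points_iso(2)[of G H S] by (simp add: C_eq simplices_volume_def)
    ultimately have "(\<Sum>H | H \<in> ?L \<and> ?g H = C. simplices_volume S len H) =
        card (?L \<inter> C) * simplices_volume S len G" by simp
    moreover have "type_volume S len C = simplices_volume S len G / card (gluing_isos S G G)"
      unfolding type_volume_def G_def[symmetric] simplices_volume_def
      using sG by (intro gluing_volume_eq S g len) (auto simp: simple_gluing_def isolated_def)
    moreover have "real (card (?L \<inter> C)) * real (card (gluing_isos S G G)) = fact n"
      using card_labelled_gluings_of_type[OF sC G n finL] by (metis of_nat_fact of_nat_mult)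
    \<comment> \<open>A product equal to \<open>n!\<close> has no zero factor, so division by the
      group order is legitimate.\<close>
    moreover from this have "real (card (gluing_isos S G G)) \<noteq> 0"
      by (metis fact_nonzero mult_zero_right)
    ultimately show ?thesis by (simp add: field_simps) (metis mult.assoc mult.commute)
  qed
  then have "fact n * (\<Sum>C\<in>types_with S n. type_volume S len C) =
      (\<Sum>C\<in>types_with S n. \<Sum>H | H \<in> ?L \<and> ?g H = C. simplices_volume S len H)"
    by (simp add: sum_distrib_left)
  also have "\<dots> = (\<Sum>H\<in>?L. simplices_volume S len H)"
    using finL by (intro sum.group) (auto simp: types_with_eq)
  finally show ?thesis by (simp add: field_simps)
qed

subsection \<open>Inclusion-exclusion and the exponential series\<close>

text \<open>Covering makes every exponent positive, so the extra factor \<open>len s\<close> undoes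
  the subtraction of 1. The remaining product runs over all incidences and can be taken point by
  point instead of circle by circle.\<close>

lemma prod_power_incidences:
  fixes len :: "'a \<Rightarrow> real"
  assumes S: "finite S" and c: "\<And>p. p < n \<Longrightarrow> c p \<subseteq> S" and cover: "\<Union> (c ` {..<n::nat}) = S"
  shows "(\<Prod>s\<in>S. len s) * (\<Prod>s\<in>S. len s ^ (card {p. p < n \<and> s \<in> c p} - 1)) =
    (\<Prod>p<n. \<Prod>s\<in>c p. len s)"
proof -
  have "(\<Prod>s\<in>S. len s) * (\<Prod>s\<in>S. len s ^ (card {p. p < n \<and> s \<in> c p} - 1)) =
      (\<Prod>s\<in>S. len s ^ card {p. p < n \<and> s \<in> c p})"
    unfolding prod.distrib[symmetric]
  proof (intro prod.cong refl)
    fix s assume "s \<in> S"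
    then have "{p. p < n \<and> s \<in> c p} \<noteq> {}" using cover by auto
    then have "card {p. p < n \<and> s \<in> c p} > 0" by (simp add: card_gt_0_iff)
    then show "len s * len s ^ (card {p. p < n \<and> s \<in> c p} - 1) = len s ^ card {p. p < n \<and> s \<in> c p}"
      by (metis mult.commute power_minus_mult)
  qed
  also have "\<dots> = (\<Prod>s\<in>S. \<Prod>p | p \<in> {..<n} \<and> s \<in> c p. len s)" by simp
  also have "\<dots> = (\<Prod>p<n. \<Prod>s | s \<in> S \<and> s \<in> c p. len s)"
    using S by (intro prod.swap_restrict) auto
  also have "\<dots> = (\<Prod>p<n. \<Prod>s\<in>c p. len s)"
    using c by (intro prod.cong refl) auto
  finally show ?thesis .
qed

text \<open>Expand the product over \<open>x \<in> S\<close> of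
  \<open>1 - of_bool (x \<notin> R)\<close>, which is 1 exactly if \<open>R = S\<close>. In the term
  for \<open>U\<close>, the second summand is taken on \<open>S - U\<close>, and it survives exactly
  if \<open>R \<subseteq> U\<close>.\<close>

lemma sum_signs_of_supersets:
  assumes S: "finite S" and R: "R \<subseteq> S"
  shows "(\<Sum>U\<in>Pow S. (-1) ^ card (S - U) * of_bool (R \<subseteq> U)) = (of_bool (R = S) :: real)"
proof -
  have "(\<Prod>x\<in>S. 1 - of_bool (x \<notin> R)) =
      (\<Sum>U\<in>Pow S. (-1) ^ (card S - card U) * (\<Prod>x\<in>U. 1) * (\<Prod>x\<in>S - U. of_bool (x \<notin> R) :: real))"
    by (rule prod_diff_conv_sum'[OF S])
  also have "\<dots> = (\<Sum>U\<in>Pow S. (-1) ^ card (S - U) * of_bool (R \<subseteq> U))"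
  proof (intro sum.cong refl)
    fix U assume U: "U \<in> Pow S"
    have "(\<Prod>x\<in>S - U. of_bool (x \<notin> R) :: real) = of_bool (R \<subseteq> U)"
      using R S by (cases "R \<subseteq> U") (auto intro!: prod.neutral)
    then show "(-1) ^ (card S - card U) * (\<Prod>x\<in>U. 1) * (\<Prod>x\<in>S - U. of_bool (x \<notin> R) :: real) =
        (-1) ^ card (S - U) * of_bool (R \<subseteq> U)"
      using U S by (simp add: card_Diff_subset finite_subset)
  qed
  also have "(\<Prod>x\<in>S. 1 - of_bool (x \<notin> R)) = (of_bool (R = S) :: real)"
    using R S by (cases "R = S") (auto intro!: prod.neutral)
  finally show ?thesis by simp
qed

text \<open>The \<open>n\<close>-th power for \<open>U\<close> sums over all maps with values in
  pairs from \<open>U\<close>. The signed sum over \<open>U\<close> then keeps exactly the maps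
  whose values cover \<open>S\<close>.\<close>

lemma sum_coverings:
  fixes w :: "circle set \<Rightarrow> real"
  assumes S: "finite S"
  shows "(\<Sum>c | c \<in> {..<n::nat} \<rightarrow>\<^sub>E simple_pairs S \<and> \<Union> (c ` {..<n}) = S. \<Prod>p<n. w (c p)) =
    (\<Sum>U\<in>Pow S. (-1) ^ card (S - U) * (\<Sum>e\<in>simple_pairs U. w e) ^ n)"
proof -
  let ?K = "{..<n} \<rightarrow>\<^sub>E simple_pairs S"
  have finK: "finite ?K" using S by (intro finite_PiE finite_simple_pairs) auto
  have R: "\<Union> (c ` {..<n}) \<subseteq> S" if "c \<in> ?K" for c
    using that by (auto simp: simple_pairs_def PiE_iff)
  have pow: "(\<Sum>e\<in>simple_pairs U. w e) ^ n =
      (\<Sum>c\<in>?K. of_bool (\<Union> (c ` {..<n}) \<subseteq> U) * (\<Prod>p<n. w (c p)))" if U: "U \<in> Pow S" for U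
  proof -
    have "(\<Sum>e\<in>simple_pairs U. w e) ^ n = (\<Prod>p<n. \<Sum>e\<in>simple_pairs U. w e)" by simp
    also have "\<dots> = (\<Sum>c\<in>{..<n} \<rightarrow>\<^sub>E simple_pairs U. \<Prod>p<n. w (c p))"
      using U S by (intro prod_sum_PiE finite_simple_pairs) (auto intro: finite_subset)
    also have "{..<n} \<rightarrow>\<^sub>E simple_pairs U = {c \<in> ?K. \<Union> (c ` {..<n}) \<subseteq> U}"
    proof -
      have "simple_pairs U = {e \<in> simple_pairs S. e \<subseteq> U}"
        using U by (auto simp: simple_pairs_def)
      then show ?thesis by (intro set_eqI) (simp add: PiE_iff UN_subset_iff, blast)
    qed
    also have "(\<Sum>c\<in>{c \<in> ?K. \<Union> (c ` {..<n}) \<subseteq> U}. \<Prod>p<n. w (c p)) =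
        (\<Sum>c\<in>?K. if \<Union> (c ` {..<n}) \<subseteq> U then \<Prod>p<n. w (c p) else 0)"
      using finK by (rule sum.inter_filter)
    also have "\<dots> = (\<Sum>c\<in>?K. of_bool (\<Union> (c ` {..<n}) \<subseteq> U) * (\<Prod>p<n. w (c p)))"
      by (intro sum.cong refl) auto
    finally show ?thesis .
  qed
  have "(\<Sum>U\<in>Pow S. (-1) ^ card (S - U) * (\<Sum>e\<in>simple_pairs U. w e) ^ n) =
      (\<Sum>U\<in>Pow S. \<Sum>c\<in>?K. (-1) ^ card (S - U) * of_bool (\<Union> (c ` {..<n}) \<subseteq> U) * (\<Prod>p<n. w (c p)))"
    by (intro sum.cong refl) (simp add: pow sum_distrib_left mult.assoc)
  also have "\<dots> = (\<Sum>c\<in>?K. \<Sum>U\<in>Pow S.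
      (-1) ^ card (S - U) * of_bool (\<Union> (c ` {..<n}) \<subseteq> U) * (\<Prod>p<n. w (c p)))"
    by (rule sum.swap)
  also have "\<dots> = (\<Sum>c\<in>?K. of_bool (\<Union> (c ` {..<n}) = S) * (\<Prod>p<n. w (c p)))"
    using sum_signs_of_supersets[OF S R] by (simp flip: sum_distrib_right)
  also have "\<dots> = (\<Sum>c\<in>?K. if \<Union> (c ` {..<n}) = S then \<Prod>p<n. w (c p) else 0)"
    by (intro sum.cong refl) auto
  also have "\<dots> = (\<Sum>c\<in>{c \<in> ?K. \<Union> (c ` {..<n}) = S}. \<Prod>p<n. w (c p))"
    using finK by (rule sum.inter_filter[symmetric])
  finally show ?thesis by simp
qed

text \<open>Each unordered pair arises from exactly two ordered ones, which accounts for the factor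
  1/2 in the exponent.\<close>

lemma sum_simple_pairs:
  fixes len :: "circle \<Rightarrow> real"
  assumes U: "finite U"
  shows "(\<Sum>e\<in>simple_pairs U. \<Prod>s\<in>e. len s) =
    1 / 2 * (\<Sum>(s, t) | s \<in> U \<and> t \<in> U \<and> colour s \<noteq> colour t. len s * len t)"
proof -
  let ?P = "{(s, t). s \<in> U \<and> t \<in> U \<and> colour s \<noteq> colour t}"
  have finP: "finite ?P" using U by (intro finite_subset[of ?P "U \<times> U"]) auto
  have "(\<Sum>(s, t)\<in>?P. len s * len t) =
      (\<Sum>e\<in>simple_pairs U. \<Sum>x | x \<in> ?P \<and> {fst x, snd x} = e. case x of (s, t) \<Rightarrow> len s * len t)"
  proof (rule sum.group[symmetric, OF finP finite_simple_pairs[OF U]])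
    show "(\<lambda>x. {fst x, snd x}) ` ?P \<subseteq> simple_pairs U"
    proof clarsimp
      fix a b c d assume "(a, b) \<in> U" "(c, d) \<in> U" "a \<noteq> c"
      then show "{(a, b), (c, d)} \<in> simple_pairs U"
        by (auto simp: simple_pairs_def card_insert_if)
    qed
  qed
  also have "\<dots> = (\<Sum>e\<in>simple_pairs U. 2 * (\<Prod>s\<in>e. len s))"
  proof (intro sum.cong refl)
    fix e assume e: "e \<in> simple_pairs U"
    then obtain a b where ab: "e = {a, b}" "a \<noteq> b"
      by (auto simp: simple_pairs_def card_2_iff)
    have "colour a \<noteq> colour b" "a \<in> U" "b \<in> U"
      using e ab by (auto simp: simple_pairs_def inj_on_def)
    then have "{x. x \<in> ?P \<and> {fst x, snd x} = e} = {(a, b), (b, a)}"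
      by (auto simp: ab doubleton_eq_iff)
    then show "(\<Sum>x | x \<in> ?P \<and> {fst x, snd x} = e. case x of (s, t) \<Rightarrow> len s * len t) =
        2 * (\<Prod>s\<in>e. len s)"
      using ab by (simp add: mult.commute)
  qed
  finally show ?thesis by (simp flip: sum_distrib_left)
qed

text \<open>There are finitely many types for each number \<open>n\<close> of points, and all
  volumes are nonnegative. The convergent series over \<open>n\<close> therefore gives an
  unconditional sum over all types.\<close>

lemma has_sum_simple_types:
  assumes S: "finite S" and len: "\<And>s. s \<in> S \<Longrightarrow> len s > 0"
  shows "(type_volume S len has_sum
    1 / (\<Prod>s\<in>S. len s) *
      (\<Sum>U\<in>Pow S. (-1) ^ card (S - U) * exp (\<Sum>e\<in>simple_pairs U. \<Prod>s\<in>e. len s)))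
    (simple_types S)"
proof -
  let ?W = "\<lambda>U. \<Sum>e\<in>simple_pairs U. \<Prod>s\<in>e. len s"
  let ?total = "1 / (\<Prod>s\<in>S. len s) * (\<Sum>U\<in>Pow S. (-1) ^ card (S - U) * exp (?W U))"
  define g where "g n = (\<Sum>C\<in>types_with S n. type_volume S len C)" for n
  have pos: "(\<Prod>s\<in>S. len s) > 0" using len by (intro prod_pos) auto
  have nonneg: "type_volume S len C \<ge> 0" for C
    by (simp add: type_volume_def gluing_volume_def)
  \<comment> \<open>The contribution of the types with \<open>n\<close> points is a signed
    combination of \<open>n\<close>-th terms of exponential series.\<close>
  have g: "g n = 1 / (\<Prod>s\<in>S. len s) * (\<Sum>U\<in>Pow S. (-1) ^ card (S - U) * (?W U ^ n /\<^sub>R fact n))" for n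
  proof -
    have "(\<Prod>s\<in>S. len s) * (\<Sum>G\<in>labelled_gluings S n. simplices_volume S len G) =
      (\<Sum>c | c \<in> {..<n} \<rightarrow>\<^sub>E simple_pairs S \<and> \<Union> (c ` {..<n}) = S.
       (\<Prod>s\<in>S. len s) * (\<Prod>s\<in>S. len s ^ (card {p. p < n \<and> s \<in> c p} - 1)))"
      unfolding sum_labelled_gluings[OF S] by (rule sum_distrib_left)
    also have "\<dots> = (\<Sum>c | c \<in> {..<n} \<rightarrow>\<^sub>E simple_pairs S \<and> \<Union> (c ` {..<n}) = S.
        \<Prod>p<n. \<Prod>s\<in>c p. len s)"
      using S by (intro sum.cong refl prod_power_incidences) auto
    also have "\<dots> = (\<Sum>U\<in>Pow S. (-1) ^ card (S - U) * ?W U ^ n)"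
      by (rule sum_coverings[OF S])
    finally have "(\<Sum>G\<in>labelled_gluings S n. simplices_volume S len G) =
        1 / (\<Prod>s\<in>S. len s) * (\<Sum>U\<in>Pow S. (-1) ^ card (S - U) * ?W U ^ n)"
      using pos by (simp add: field_simps)
    then have "g n = 1 / (\<Prod>s\<in>S. len s) * ((\<Sum>U\<in>Pow S. (-1) ^ card (S - U) * ?W U ^ n) / fact n)"
      unfolding g_def using sum_types_with[OF S, of len n] len by (simp add: less_imp_le)
    then show ?thesis
      by (simp add: sum_divide_distrib field_simps)
  qed
  have "g sums ?total"
    unfolding g by (intro sums_mult sums_sum exp_converges)
  then have g_sum: "(g has_sum ?total) UNIV"
    using nonneg by (intro sums_nonneg_imp_has_sum) (auto simp: g_def intro: sum_nonneg)
  have fin: "finite (types_with S n)" for n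
    unfolding types_with_eq using finite_labelled_gluings[OF S] by simp
  have inner: "((\<lambda>C. (type_volume S len \<circ> snd) (n, C)) has_sum g n) (types_with S n)" for n
    using has_sum_finite[OF fin, of "type_volume S len" n] by (simp add: g_def)
  have "(type_volume S len \<circ> snd) summable_on (SIGMA n:UNIV. types_with S n)"
    using g_sum nonneg by (intro summable_on_SigmaI[OF inner]) (auto simp: summable_on_def)
  then have "((type_volume S len \<circ> snd) has_sum ?total) (SIGMA n:UNIV. types_with S n)"
    using inner g_sum by (intro has_sum_SigmaI) auto
  \<comment> \<open>A class is non-empty and all its members have equally many points, so a type
    occurs for exactly one \<open>n\<close>.\<close>
  moreover have "bij_betw snd (SIGMA n:UNIV. types_with S n) (simple_types S)"
  proof (rule bij_betw_imageI)
    show "inj_on snd (SIGMA n:UNIV. types_with S n)"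
    proof (rule inj_onI, clarsimp)
      fix n m C assume "C \<in> types_with S n" "C \<in> types_with S m"
      moreover from this have "(SOME G. G \<in> C) \<in> C"
        by (intro simple_types_some) (auto simp: types_with_def)
      ultimately show "n = m" by (auto simp: types_with_def)
    qed
    show "snd ` (SIGMA n:UNIV. types_with S n) = simple_types S"
    proof (intro equalityI subsetI)
      fix C assume C: "C \<in> simple_types S"
      define G where "G = (SOME G. G \<in> C)"
      have G: "G \<in> C" unfolding G_def using simple_types_some[OF C] .
      have "C \<in> types_with S (card (gluing_points G))"
        using C card_gluing_points_iso(1)[of G _ S] simple_types_memD(2)[OF C G]
        by (auto simp: types_with_def)
      then show "C \<in> snd ` (SIGMA n:UNIV. types_with S n)" by force
    qed (auto simp: types_with_def)
  qed
  ultimately show ?thesis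
    using has_sum_reindex_bij_betw[of snd "SIGMA n:UNIV. types_with S n" "simple_types S"
        "type_volume S len" ?total]
    unfolding o_def by blast
qed

section \<open>From subsets of all circles to divisions colour by colour\<close>

lemma card_circles_Diff:
  assumes "U \<subseteq> circles k m"
  shows "card (circles k m - U) = (\<Sum>i = 1..k. card ({1..m i} - {j. (i, j) \<in> U}))"
proof -
  have "circles k m - U = (SIGMA i:{1..k}. {1..m i} - {j. (i, j) \<in> U})"
    by (auto simp: circles_def)
  then show ?thesis by simp
qed

text \<open>Ordered pairs of circles are grouped by their ordered pair of colours; each group
  contributes a product of two total lengths.\<close>

lemma sum_bichromatic_pairs:
  fixes l :: "nat \<Rightarrow> nat \<Rightarrow> real"
  assumes U: "U \<subseteq> circles k m"
  shows "(\<Sum>(s, t) | s \<in> U \<and> t \<in> U \<and> colour s \<noteq> colour t. (\<lambda>(i, j). l i j) s * (\<lambda>(i, j). l i j) t) =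
    (\<Sum>(i, j) \<in> {(i, j). i \<in> {1..k} \<and> j \<in> {1..k} \<and> i \<noteq> j}.
       (\<Sum>r | (i, r) \<in> U. l i r) * (\<Sum>r | (j, r) \<in> U. l j r))"
proof -
  let ?I = "{(i, j). i \<in> {1..k} \<and> j \<in> {1..k} \<and> i \<noteq> j}"
  let ?U = "\<lambda>i. {r. (i, r) \<in> U}"
  have finI: "finite ?I" by (rule finite_subset[of _ "{1..k} \<times> {1..k}"]) auto
  have finU: "finite (?U i)" for i
  proof (rule finite_subset)
    show "?U i \<subseteq> {1..m i}" using U unfolding circles_def by blast
  qed simp
  have "(\<Sum>(i, j)\<in>?I. (\<Sum>r\<in>?U i. l i r) * (\<Sum>r\<in>?U j. l j r)) =
      (\<Sum>x\<in>?I. \<Sum>y\<in>?U (fst x) \<times> ?U (snd x). l (fst x) (fst y) * l (snd x) (snd y))"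
    by (intro sum.cong refl) (auto simp: sum_product sum.cartesian_product split_beta)
  also have "\<dots> = (\<Sum>(x, y)\<in>(SIGMA x:?I. ?U (fst x) \<times> ?U (snd x)).
      l (fst x) (fst y) * l (snd x) (snd y))"
    using finI finU by (intro sum.Sigma) auto
  also have "\<dots> = (\<Sum>(s, t) | s \<in> U \<and> t \<in> U \<and> colour s \<noteq> colour t.
      (\<lambda>(i, j). l i j) s * (\<lambda>(i, j). l i j) t)"
    using U
    by (intro sum.reindex_bij_witness[of _ "\<lambda>((i, r), (j, q)). ((i, j), (r, q))"
        "\<lambda>((i, j), (r, q)). ((i, r), (j, q))"]) (auto simp: circles_def)
  finally show ?thesis by simp
qed

text \<open>A division is determined by its first component, the second being the complement in each
  colour. The first component, an extensional family, corresponds to the subset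
  \<open>Sigma {1..k} U\<close> of the circles.\<close>

lemma sum_divisions:
  "(\<Sum>(U, V) \<in> divisions k m. F U V) =
    (\<Sum>U\<in>Pow (circles k m).
       F (\<lambda>i\<in>{1..k}. {j. (i, j) \<in> U}) (\<lambda>i\<in>{1..k}. {1..m i} - {j. (i, j) \<in> U}))"
proof (rule sum.reindex_bij_witness[symmetric, of _ "\<lambda>(U, V). Sigma {1..k} U"
      "\<lambda>U. (\<lambda>i\<in>{1..k}. {j. (i, j) \<in> U}, \<lambda>i\<in>{1..k}. {1..m i} - {j. (i, j) \<in> U})"])
  fix U assume U: "U \<in> Pow (circles k m)"
  then show "(case (\<lambda>i\<in>{1..k}. {j. (i, j) \<in> U}, \<lambda>i\<in>{1..k}. {1..m i} - {j. (i, j) \<in> U}) of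
      (U, V) \<Rightarrow> Sigma {1..k} U) = U"
    by (auto simp: circles_def)
  show "(\<lambda>i\<in>{1..k}. {j. (i, j) \<in> U}, \<lambda>i\<in>{1..k}. {1..m i} - {j. (i, j) \<in> U}) \<in> divisions k m"
    using U by (auto simp: circles_def divisions_def)
next
  fix d assume "d \<in> divisions k m"
  then obtain U V where d: "d = (U, V)" and U: "U \<in> (\<Pi>\<^sub>E i \<in> {1..k}. Pow {1..m i})"
    and V: "V \<in> (\<Pi>\<^sub>E i \<in> {1..k}. Pow {1..m i})"
    and UV: "\<And>i. i \<in> {1..k} \<Longrightarrow> U i \<union> V i = {1..m i} \<and> U i \<inter> V i = {}"
    by (auto simp: divisions_def)
  have "{1..m i} - U i = V i" if "i \<in> {1..k}" for i
    using UV[OF that] by blast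
  then have "(\<lambda>i\<in>{1..k}. {1..m i} - {j. (i, j) \<in> Sigma {1..k} U}) = V"
    using V by (intro extensionalityI[of _ "{1..k}"]) (auto simp: PiE_def)
  moreover have "(\<lambda>i\<in>{1..k}. {j. (i, j) \<in> Sigma {1..k} U}) = U"
    using U by (intro extensionalityI[of _ "{1..k}"]) (auto simp: PiE_def)
  ultimately show "(\<lambda>i\<in>{1..k}. {j. (i, j) \<in> (case d of (U, V) \<Rightarrow> Sigma {1..k} U)},
      \<lambda>i\<in>{1..k}. {1..m i} - {j. (i, j) \<in> (case d of (U, V) \<Rightarrow> Sigma {1..k} U)}) = d"
    by (simp add: d)
  show "(case d of (U, V) \<Rightarrow> Sigma {1..k} U) \<in> Pow (circles k m)"
    using U by (auto simp: d circles_def PiE_iff)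
qed simp

theorem theorem8:
  fixes k :: nat and m :: "nat \<Rightarrow> nat" and l :: "nat \<Rightarrow> nat \<Rightarrow> real"
  assumes "k \<ge> 2"
    and "\<And>i j. i \<in> {1..k} \<Longrightarrow> j \<in> {1..m i} \<Longrightarrow> l i j > 0"
  shows "((\<lambda>C. type_volume (circles k m) (\<lambda>(i, j). l i j) C) has_sum
      1 / (\<Prod>i = 1..k. \<Prod>j = 1..m i. l i j) *
      (\<Sum>(U, V) \<in> divisions k m.
         (-1) ^ (\<Sum>i = 1..k. card (V i)) *
         exp (1 / 2 * (\<Sum>(i, j) \<in> {(i, j). i \<in> {1..k} \<and> j \<in> {1..k} \<and> i \<noteq> j}.
           (\<Sum>r \<in> U i. l i r) * (\<Sum>r \<in> U j. l j r)))))
    (simple_types (circles k m))"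
proof -
  let ?S = "circles k m" and ?len = "\<lambda>(i, j). l i j"
  let ?I = "{(i, j). i \<in> {1..k} \<and> j \<in> {1..k} \<and> i \<noteq> j}"
  let ?F = "\<lambda>U V. (-1) ^ (\<Sum>i = 1..k. card (V i)) *
    exp (1 / 2 * (\<Sum>(i, j) \<in> ?I. (\<Sum>r \<in> U i. l i r) * (\<Sum>r \<in> U j. l j r)))"
  have S: "finite ?S" by (simp add: circles_def)
  have "(\<Sum>(U, V) \<in> divisions k m. ?F U V) =
      (\<Sum>U\<in>Pow ?S. (-1) ^ card (?S - U) * exp (\<Sum>e\<in>simple_pairs U. \<Prod>s\<in>e. ?len s))"
    unfolding sum_divisions
  proof (rule sum.cong[OF refl])
    fix U assume "U \<in> Pow ?S"
    then have U: "U \<subseteq> ?S" by simp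
    then have "finite U" using S finite_subset by blast
    have "(\<Sum>(i, j) \<in> ?I. (\<Sum>r \<in> (\<lambda>i\<in>{1..k}. {j. (i, j) \<in> U}) i. l i r) *
        (\<Sum>r \<in> (\<lambda>i\<in>{1..k}. {j. (i, j) \<in> U}) j. l j r)) =
        (\<Sum>(i, j) \<in> ?I. (\<Sum>r | (i, r) \<in> U. l i r) * (\<Sum>r | (j, r) \<in> U. l j r))"
      by (rule sum.cong) auto
    then show "?F (\<lambda>i\<in>{1..k}. {j. (i, j) \<in> U}) (\<lambda>i\<in>{1..k}. {1..m i} - {j. (i, j) \<in> U}) =
        (-1) ^ card (?S - U) * exp (\<Sum>e\<in>simple_pairs U. \<Prod>s\<in>e. ?len s)"
      unfolding sum_simple_pairs[OF \<open>finite U\<close>] sum_bichromatic_pairs[OF U] card_circles_Diff[OF U]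
      by simp
  qed
  moreover have "(\<Prod>i = 1..k. \<Prod>j = 1..m i. l i j) = (\<Prod>s\<in>?S. ?len s)"
    by (simp add: circles_def prod.Sigma)
  moreover have "(type_volume ?S ?len has_sum 1 / (\<Prod>s\<in>?S. ?len s) *
      (\<Sum>U\<in>Pow ?S. (-1) ^ card (?S - U) * exp (\<Sum>e\<in>simple_pairs U. \<Prod>s\<in>e. ?len s)))
      (simple_types ?S)"
  proof (rule has_sum_simple_types[OF S])
    show "?len s > 0" if "s \<in> ?S" for s
      using that assms(2) unfolding circles_def by (elim SigmaE) simp
  qed
  ultimately show ?thesis by (simp only:)
qed

end
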